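(* Let $x_1,\dots,x_m$, $y_1,\dots,y_n$ be variables and $z_1,z_2,\dots$ nonzero parameters. Then $$\sum_\lambda G_\lambda(x_1,\dots,x_m;z_1,\dots,z_m)\,g_\lambda\big(y_1,\dots,y_n;\tfrac1{z_1},\tfrac1{z_2},\dots\big)=\prod_{1\le i\le m,\,1\le j\le n}\frac1{1-x_iy_j},$$ summing over all partitions (formal power series identity).
   Context: Lattice conventions: a vertex has left label $a$, bottom $b$, right $c$, top $d$, weight $0$ unless $a+b=c+d$. A row is a sequence of vertices at sites $s=1,2,\dots$, right label at site $s$ = left label at site $s+1$; vertical and horizontal labels are nonnegative integers; the left label at site 1 is free (summed over), the right labels are eventually $0$. Rows $1,\dots,N$ are stacked bottom to top (top labels of row $k$ = bottom labels of row $k+1$), bottom boundary all $0$, top boundary $(m^c_s(\lambda))_{s\ge1}$, $m^c_s(\lambda)=\lambda_s-\lambda_{s+1}$. Partition function = sum over labelings of non-prescribed edges of product of weights. Generalised Grothendieck polynomial $G_\lambda(x_1,\dots,x_m;z_1,\dots,z_m)$: $N=m$, vertex in row $i$, site $s$ has weight $U_{x_i/z_s}$, $U_u(a,b;c,d)=u^a$ if $b=c$, $u^a(1-u)$ if $b>c$, $0$ if $b<c$ (only sites $s\le m$ can carry nonempty vertices, so only $z_1,\dots,z_m$ enter; for $z_s=1$ this is $G^{(0,-1)}_\lambda$). Generalised dual Grothendieck polynomial $g_\lambda(y_1,\dots,y_n;w_1,w_2,\dots)$: $N=n$, vertex in row $i$, site $s$ has weight $(y_i/w_s)^{\min(a,d)}$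 (for $w_s=1$ this is $g^{(0,1)}_\lambda$); in $g_\lambda(y;1/z_1,1/z_2,\dots)$ the weight is $(y_iz_s)^{\min(a,d)}$. *)

theory Defs
  imports Complex_Main "HOL-Library.Multiset"
begin

section \<open>Formal power series in many variables\<close>

text \<open>A monomial is a finite multiset of variables, e.g. \<open>{#v, v, w#}\<close> stands for
  \<open>v\<^sup>2 w\<close>; a formal power series is an arbitrary family of coefficients
  indexed by monomials.\<close>

typedef ('v, 'a) mfps = "UNIV :: ('v multiset \<Rightarrow> 'a) set"
  morphisms mcoeff Abs_mfps by simp

lemma mcoeff_Abs [simp]: "mcoeff (Abs_mfps f) = f"
  by (simp add: Abs_mfps_inverse)

lemma mfps_eqI: "(\<And>M. mcoeff f M = mcoeff g M) \<Longrightarrow> f = g"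
  by (metis ext mcoeff_inject)

lemma finite_submultisets: "finite {A. A \<subseteq># (M :: 'v multiset)}"
proof (induction M)
  case (add x M)
  have "{A. A \<subseteq># add_mset x M} \<subseteq> {A. A \<subseteq># M} \<union> add_mset x ` {A. A \<subseteq># M}"
  proof
    fix A assume A: "A \<in> {A. A \<subseteq># add_mset x M}"
    show "A \<in> {A. A \<subseteq># M} \<union> add_mset x ` {A. A \<subseteq># M}"
    proof (cases "x \<in># A")
      case True
      then obtain B where "A = add_mset x B" by (metis insert_DiffM)
      then show ?thesis using A by simp
    next
      case False
      then show ?thesis using A
        by (metis UnI1 diff_single_trivial mem_Collect_eq subset_eq_diff_conv
              add_mset_add_single)
    qed
  qed
  then show ?case using add by (meson finite_UnI finite_imageI finite_subset)
qed simp

lemma finite_multiset_antidiagonal: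
  "finite {(A, B). A + B = (M :: 'v multiset)}"
proof (rule finite_subset)
  show "{(A, B). A + B = M} \<subseteq> {A. A \<subseteq># M} \<times> {A. A \<subseteq># M}"
    by (auto simp: subset_mset.le_iff_add)
qed (simp add: finite_submultisets)

lemma multiset_antidiagonal_assoc:
  fixes f g h :: "'v multiset \<Rightarrow> 'a :: comm_ring_1"
  shows "(\<Sum>(D, C) | D + C = M. (\<Sum>(A, B) | A + B = D. f A * g B) * h C) =
         (\<Sum>(A, D) | A + D = M. f A * (\<Sum>(B, C) | B + C = D. g B * h C))"
proof -
  note fin = finite_multiset_antidiagonal
  have fin': "\<And>D :: 'v multiset. finite {p. fst p + snd p = D}"
    using fin unfolding case_prod_unfold .
  have "(\<Sum>(D, C) | D + C = M. (\<Sum>(A, B) | A + B = D. f A * g B) * h C) =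
        (\<Sum>(p, q) \<in> Sigma {p. fst p + snd p = M} (\<lambda>p. {q. fst q + snd q = fst p}).
           f (fst q) * g (snd q) * h (snd p))"
    unfolding case_prod_unfold sum_distrib_right
    by (subst sum.Sigma) (auto simp: fin' case_prod_unfold)
  also have "\<dots> = (\<Sum>(p, q) \<in> Sigma {p. fst p + snd p = M} (\<lambda>p. {q. fst q + snd q = snd p}).
           f (fst p) * (g (fst q) * h (snd q)))"
    by (rule sum.reindex_bij_witness
          [where i = "\<lambda>(p, q). ((fst p + fst q, snd q), (fst p, fst q))"
             and j = "\<lambda>(p, q). ((fst q, snd q + snd p), (snd q, snd p))"])
       (auto simp: add.assoc mult.assoc)
  also have "\<dots> = (\<Sum>(A, D) | A + D = M. f A * (\<Sum>(B, C) | B + C = D. g B * h C))"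
    unfolding case_prod_unfold sum_distrib_left
    by (subst sum.Sigma) (auto simp: fin' case_prod_unfold)
  finally show ?thesis .
qed

instantiation mfps :: (type, comm_ring_1) comm_ring_1
begin

definition "0 = Abs_mfps (\<lambda>_. 0)"
definition "1 = Abs_mfps (\<lambda>M. if M = {#} then 1 else 0)"
definition "f + g = Abs_mfps (\<lambda>M. mcoeff f M + mcoeff g M)"
definition "f - g = Abs_mfps (\<lambda>M. mcoeff f M - mcoeff g M)"
definition "- f = Abs_mfps (\<lambda>M. - mcoeff f M)"
definition "f * g = Abs_mfps (\<lambda>M. \<Sum>(A, B) | A + B = M. mcoeff f A * mcoeff g B)"

instance
proof
  fix f g h :: "('a, 'b) mfps"
  show "f * g * h = f * (g * h)"
    by (simp add: times_mfps_def multiset_antidiagonal_assoc)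
  show "f * g = g * f"
    unfolding times_mfps_def
    by (intro arg_cong[where f = Abs_mfps] ext
          sum.reindex_bij_witness[where i = prod.swap and j = prod.swap])
       (auto simp: add.commute mult.commute)
  show "1 * f = f"
  proof (rule mfps_eqI)
    fix M
    have "mcoeff (1 * f) M =
      (\<Sum>(A, B) | A + B = M. (if A = {#} then 1 else 0) * mcoeff f B)"
      by (simp add: times_mfps_def one_mfps_def)
    also have "\<dots> = (\<Sum>(A, B) \<in> {({#} :: 'a multiset, M)}. (if A = {#} then 1 else 0) * mcoeff f B)"
      by (intro sum.mono_neutral_right finite_multiset_antidiagonal)
         (auto split: if_splits)
    finally show "mcoeff (1 * f) M = mcoeff f M" by simp
  qed
  show "(f + g) * h = f * h + g * h"
    by (simp add: times_mfps_def plus_mfps_def algebra_simps case_prod_beta sum.distrib)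
  show "(0 :: ('a, 'b) mfps) \<noteq> 1"
    by (auto simp: zero_mfps_def one_mfps_def Abs_mfps_inject dest: fun_cong[of _ _ "{#}"])
  show "f + g + h = f + (g + h)" "f + g = g + f" "0 + f = f" "- f + f = 0" "f - g = f + - g"
    by (simp_all add: plus_mfps_def minus_mfps_def uminus_mfps_def zero_mfps_def
          mcoeff_inverse add_ac)
qed

end

text \<open>The inverse of a non-unit is set to 0.\<close>

instantiation mfps :: (type, comm_ring_1) inverse
begin

definition "inverse f = (if \<exists>g. f * g = 1 then THE g. f * g = 1 else (0 :: ('a, 'b) mfps))"
definition "f div g = f * inverse (g :: ('a, 'b) mfps)"

instance ..

end

definition mconst :: "'a \<Rightarrow> ('v, 'a :: comm_ring_1) mfps" where
  "mconst c = Abs_mfps (\<lambda>M. if M = {#} then c else 0)"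

definition mvar :: "'v \<Rightarrow> ('v, 'a :: comm_ring_1) mfps" where
  "mvar v = Abs_mfps (\<lambda>M. if M = {#v#} then 1 else 0)"

text \<open>Formal (coefficientwise finite) summation of a possibly infinite family.\<close>

definition has_formal_sum ::
    "('i \<Rightarrow> ('v, 'a :: comm_ring_1) mfps) \<Rightarrow> 'i set \<Rightarrow> ('v, 'a) mfps \<Rightarrow> bool" where
  "has_formal_sum F I S \<longleftrightarrow>
     (\<forall>M. finite {i \<in> I. mcoeff (F i) M \<noteq> 0} \<and>
          (\<Sum>i \<in> {i \<in> I. mcoeff (F i) M \<noteq> 0}. mcoeff (F i) M) = mcoeff S M)"

lemma mfps_inverse_unique:
  assumes "f * g = (1 :: ('v, 'a :: comm_ring_1) mfps)"
  shows "inverse f = g"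
proof -
  have "g' = g" if "f * g' = 1" for g'
  proof -
    have "g' = (f * g) * g'" using assms by simp
    also have "\<dots> = (f * g') * g" by (simp only: mult_ac)
    finally show ?thesis using that by simp
  qed
  then have "(THE g. f * g = 1) = g"
    using assms by (intro the_equality)
  moreover have "\<exists>g. f * g = 1"
    using assms by (rule exI)
  ultimately show ?thesis
    unfolding inverse_mfps_def by (simp only: if_True)
qed

lemma mconst_mult: "mconst a * mconst b = mconst (a * b)"
proof (rule mfps_eqI)
  fix M :: "'v multiset"
  have "mcoeff (mconst a * mconst b) M =
    (\<Sum>(A, B) | A + B = M. if A = {#} \<and> B = {#} then a * b else 0)"
    by (simp add: times_mfps_def mconst_def) (rule sum.cong, auto)
  also have "\<dots> = (\<Sum>(A, B) \<in> {(A, B). A + B = M} \<inter> {({#}, {#})}. a * b)"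
    by (intro sum.mono_neutral_cong_right finite_multiset_antidiagonal)
       (auto split: if_splits)
  also have "{(A, B). A + B = M} \<inter> {({#}, {#})} = (if M = {#} then {({#}, {#})} else {})"
    by auto
  finally show "mcoeff (mconst a * mconst b) M = mcoeff (mconst (a * b)) M"
    by (simp add: mconst_def split: if_splits)
qed

lemma mfps_divide_mconst:
  fixes f :: "('v, 'a :: field) mfps"
  assumes "c \<noteq> 0"
  shows "f / mconst c = f * mconst (1 / c)"
proof -
  have "mconst c * mconst (1 / c) = (1 :: ('v, 'a) mfps)"
    using assms by (simp add: mconst_mult) (simp add: mconst_def one_mfps_def)
  then show ?thesis
    by (simp add: divide_mfps_def mfps_inverse_unique)
qed


section \<open>Partitions and the lattice partition function\<close>

text \<open>A partition \<open>\<lambda>\<^sub>1 \<ge> \<lambda>\<^sub>2 \<ge> \<dots>\<close> is a sequence indexed from 1; the unused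
  entry at index 0 is fixed to 0 so that each partition is represented exactly once.\<close>

definition partitions :: "(nat \<Rightarrow> nat) set" where
  "partitions = {l. l 0 = 0 \<and> (\<forall>s\<ge>1. l (s + 1) \<le> l s) \<and> finite {s. l s \<noteq> 0}}"

text \<open>A labeling \<open>(h, v)\<close> of \<open>N\<close> rows: \<open>h k s\<close> is the left label of the vertex in row
  \<open>k\<close> and site \<open>s\<close> (hence the right label of the one at site \<open>s - 1\<close>), \<open>v k s\<close> its top
  label (hence the bottom label in row \<open>k + 1\<close>). Entries that label no edge are set to 0.
  Only labelings with \<open>a + b = c + d\<close> at every vertex are kept, all others having weight 0;
  this makes the set finite.\<close>

definition labelings ::
    "nat \<Rightarrow> (nat \<Rightarrow> nat) \<Rightarrow> ((nat \<Rightarrow> nat \<Rightarrow> nat) \<times> (nat \<Rightarrow> nat \<Rightarrow> nat)) set" where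
  "labelings N l = {(h, v).
     (\<forall>k s. k \<notin> {1..N} \<or> s = 0 \<longrightarrow> h k s = 0) \<and>
     (\<forall>k s. k > N \<or> s = 0 \<longrightarrow> v k s = 0) \<and>
     (\<forall>s\<ge>1. v 0 s = 0) \<and>
     (\<forall>s\<ge>1. v N s = l s - l (s + 1)) \<and>
     (\<forall>k\<in>{1..N}. \<forall>s\<ge>1. h k s + v (k - 1) s = h k (s + 1) + v k s) \<and>
     (\<forall>k\<in>{1..N}. \<exists>S. \<forall>s\<ge>S. h k (s + 1) = 0)}"

text \<open>The weight \<open>W k s a b c d\<close> of the vertex in row \<open>k\<close> and site \<open>s\<close> has to be 1 for
  \<open>a = b = c = d = 0\<close>. Then all but finitely many sites contribute a factor 1, and the
  infinite product over the sites is the product over those with a factor different from 1.\<close>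

definition partition_function ::
    "nat \<Rightarrow> (nat \<Rightarrow> nat \<Rightarrow> nat \<Rightarrow> nat \<Rightarrow> nat \<Rightarrow> nat \<Rightarrow> 'r :: comm_ring_1) \<Rightarrow> (nat \<Rightarrow> nat) \<Rightarrow> 'r" where
  "partition_function N W l =
     (\<Sum>(h, v) \<in> labelings N l. \<Prod>k = 1..N.
        let w = (\<lambda>s. W k s (h k s) (v (k - 1) s) (h k (s + 1)) (v k s))
        in \<Prod>s \<in> {s. s \<ge> 1 \<and> w s \<noteq> 1}. w s)"

lemma labelings_bounded:
  assumes l: "l \<in> partitions" and hv: "(h, v) \<in> labelings N l"
  shows "h k s \<le> l s" and "v k s \<le> l s"
proof -
  have h0: "h k s = 0" if "k \<notin> {1..N} \<or> s = 0" for k s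
    using hv that by (auto simp: labelings_def)
  have v0: "v k s = 0" if "k > N \<or> k = 0 \<or> s = 0" for k s
    using hv that by (cases "s = 0") (auto simp: labelings_def)
  have vN: "v N s = l s - l (s + 1)" if "s \<ge> 1" for s
    using hv that by (auto simp: labelings_def)
  have cons: "h k s + v (k - 1) s = h k (s + 1) + v k s" if "k \<in> {1..N}" "s \<ge> 1" for k s
    using hv that by (auto simp: labelings_def)
  have "\<forall>k\<in>{1..N}. \<exists>S. \<forall>s\<ge>S. h k (s + 1) = 0"
    using hv by (auto simp: labelings_def)
  then obtain T where T: "\<And>k s. k \<in> {1..N} \<Longrightarrow> s \<ge> T k \<Longrightarrow> h k (s + 1) = 0"
    by metis
  have lmono: "l (s + 1) \<le> l s" if "s \<ge> 1" for s
    using l that by (auto simp: partitions_def)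
  have "finite {s. l s \<noteq> 0}"
    using l by (simp add: partitions_def)
  then obtain L where "\<And>s. s \<in> {s. l s \<noteq> 0} \<Longrightarrow> s < L"
    unfolding finite_nat_set_iff_bounded by blast
  then have L: "l s = 0" if "s \<ge> L" for s
    using that by (metis (mono_tags) linorder_not_le mem_Collect_eq)
  define H where "H s = (\<Sum>k = 1..N. h k s)" for s
  define R where "R = L + (\<Sum>k = 1..N. T k) + 1"
  have tel: "(\<Sum>k = 1..j. h k s) + v 0 s = (\<Sum>k = 1..j. h k (s + 1)) + v j s"
    if "s \<ge> 1" "j \<le> N" for s j
    using that(2)
  proof (induction j)
    case (Suc j)
    then show ?case using cons[of "Suc j" s] that(1) by simp
  qed simp
  have HR: "H s = 0" if "s \<ge> R" for s
  proof -
    have "h k s = 0" if k: "k \<in> {1..N}" for k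
    proof -
      have "T k \<le> (\<Sum>k = 1..N. T k)" by (rule member_le_sum) (use k in auto)
      then show ?thesis using T[OF k, of "s - 1"] \<open>s \<ge> R\<close> by (simp add: R_def)
    qed
    then show ?thesis by (simp add: H_def)
  qed
  have Hstep: "H s = H (s + 1) + (l s - l (s + 1))" if "s \<ge> 1" for s
    using tel[OF that, of N] v0[of 0 s] vN[OF that] by (simp add: H_def)
  have HL: "H s = l s" if "s \<ge> 1" for s
  proof (cases "s \<le> R")
    case True
    then show ?thesis using that
    proof (induction rule: inc_induct)
      case base
      then show ?case using HR[of R] L[of R] by (simp add: R_def)
    next
      case (step n)
      then show ?case using Hstep[of n] lmono[of n] by simp
    qed
  next
    case False
    then show ?thesis using HR[of s] L[of s] by (simp add: R_def)
  qed
  have sub: "(\<Sum>k\<in>A. h k s) \<le> l s" if "A \<subseteq> {1..N}" "s \<ge> 1" for A s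
    using sum_mono2[of "{1..N}" A "\<lambda>k. h k s"] HL[of s] that by (simp add: H_def)
  show "h k s \<le> l s"
    using sub[of "{k}" s] h0[of k s] by (cases "k \<in> {1..N} \<and> s \<ge> 1") auto
  show "v k s \<le> l s"
  proof (cases "k \<le> N \<and> s \<ge> 1")
    case True
    then show ?thesis using tel[of s k] sub[of "{1..k}" s] v0[of 0 s] by simp
  next
    case False
    then show ?thesis using v0[of k s] by auto
  qed
qed

lemma finite_labelings:
  assumes "l \<in> partitions"
  shows "finite (labelings N l)"
proof -
  have fin: "finite {s. l s \<noteq> 0}"
    using assms by (auto simp: partitions_def)
  define E where "E = {0..N} \<times> {s. l s \<noteq> 0}"
  define B where "B = Max (insert 0 (l ` {s. l s \<noteq> 0}))"
  define F where "F = {f :: nat \<times> nat \<Rightarrow> nat. \<forall>p. (p \<in> E \<longrightarrow> f p \<in> {0..B}) \<and> (p \<notin> E \<longrightarrow> f p = 0)}"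
  have lB: "l s \<le> B" for s
    unfolding B_def using fin by (cases "l s = 0") auto
  have "finite F"
    unfolding F_def by (rule finite_set_of_finite_funs) (use fin in \<open>auto simp: E_def\<close>)
  then have "finite ((\<lambda>(f, g). (curry f, curry g)) ` (F \<times> F))" by blast
  moreover have "labelings N l \<subseteq> (\<lambda>(f, g). (curry f, curry g)) ` (F \<times> F)"
  proof (clarify)
    fix h v assume hv: "(h, v) \<in> labelings N l"
    note bd = labelings_bounded[OF assms hv]
    have z: "h k s = 0" "v k s = 0" if "k > N" for k s
      using hv that by (auto simp: labelings_def)
    have "h k s \<le> B \<and> v k s \<le> B" for k s
      using le_trans[OF bd(1) lB] le_trans[OF bd(2) lB] by blast
    moreover have "h k s = 0 \<and> v k s = 0" if "(k, s) \<notin> E" for k s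
      using that z[of k s] bd(1)[of k s] bd(2)[of k s] by (cases "k > N") (auto simp: E_def)
    ultimately have "case_prod h \<in> F" "case_prod v \<in> F"
      unfolding F_def by auto
    then show "(h, v) \<in> (\<lambda>(f, g). (curry f, curry g)) ` (F \<times> F)"
      by (intro image_eqI[of _ _ "(case_prod h, case_prod v)"]) auto
  qed
  ultimately show ?thesis by (rule finite_subset[rotated])
qed


section \<open>Generalised Grothendieck polynomials and their duals\<close>

definition U_weight :: "'r \<Rightarrow> nat \<Rightarrow> nat \<Rightarrow> nat \<Rightarrow> nat \<Rightarrow> 'r :: comm_ring_1" where
  "U_weight u a b c d =
     (if a + b \<noteq> c + d then 0
      else if b = c then u ^ a
      else if b > c then u ^ a * (1 - u)
      else 0)"

definition dual_weight :: "'r \<Rightarrow> nat \<Rightarrow> nat \<Rightarrow> nat \<Rightarrow> nat \<Rightarrow> 'r :: comm_ring_1" where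
  "dual_weight u a b c d = (if a + b \<noteq> c + d then 0 else u ^ min a d)"

definition Grothendieck ::
    "nat \<Rightarrow> (nat \<Rightarrow> nat) \<Rightarrow> (nat \<Rightarrow> 'r) \<Rightarrow> (nat \<Rightarrow> 'r) \<Rightarrow> 'r :: {comm_ring_1, inverse}" where
  "Grothendieck m l x z = partition_function m (\<lambda>i s. U_weight (x i / z s)) l"

definition dual_Grothendieck ::
    "nat \<Rightarrow> (nat \<Rightarrow> nat) \<Rightarrow> (nat \<Rightarrow> 'r) \<Rightarrow> (nat \<Rightarrow> 'r) \<Rightarrow> 'r :: {comm_ring_1, inverse}" where
  "dual_Grothendieck n l y w = partition_function n (\<lambda>i s. dual_weight (y i / w s)) l"

datatype xy_var = X nat | Y nat

end

theory Submission
  imports Defs "HOL-Library.FuncSet"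
begin

text \<open>Conservation at the vertices turns a labeling into a chain of partitions
  \<open>\<emptyset> = \<lambda>\<^sup>0 \<subseteq> \<dots> \<subseteq> \<lambda>\<^sup>N = \<lambda>\<close>, the horizontal labels of row \<open>k\<close> being the differences
  \<open>\<lambda>\<^sup>k\<^sub>s - \<lambda>\<^sup>k\<^sup>-\<^sup>1\<^sub>s\<close>. Write \<open>U \<mu> \<lambda>\<close> and \<open>D \<mu> \<lambda>\<close> for the weights of one row of the two models,
  with \<open>u\<^sub>s = x / z\<^sub>s\<close> and \<open>v\<^sub>s = y z\<^sub>s\<close>. They commute up to a scalar,
  \<open>\<Sum>\<^sub>\<lambda> U \<mu> \<lambda> D \<nu> \<lambda> = 1 / (1 - x y) \<Sum>\<^sub>\<kappa> D \<kappa> \<mu> U \<kappa> \<nu>\<close>: the parts \<open>\<lambda>\<^sub>1, \<lambda>\<^sub>2, \<dots>\<close> (and \<open>\<kappa>\<^sub>1, \<kappa>\<^sub>2, \<dots>\<close>)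
  range independently over intervals, because \<open>U\<close> vanishes off horizontal strips and \<open>u\<^sub>s v\<^sub>s = x y\<close>
  does not depend on \<open>s\<close>, so both sides are products over the sites. The sum over \<open>\<lambda>\<^sub>1\<close> is the
  geometric series, and the sum over \<open>\<lambda>\<^sub>s\<^sub>+\<^sub>1\<close> equals the one over \<open>\<kappa>\<^sub>s\<close> by telescoping. Pushing
  all \<open>U\<close> rows through all \<open>D\<close> rows gives the theorem.\<close>

section \<open>Degree and formal summation\<close>

text \<open>A lower bound on the order of a series. In the form of a predicate it also covers the
  zero series, whose order is infinite.\<close>

definition mdeg_ge :: "('v, 'a :: comm_ring_1) mfps \<Rightarrow> nat \<Rightarrow> bool" where
  "mdeg_ge f d \<longleftrightarrow> (\<forall>M. size M < d \<longrightarrow> mcoeff f M = 0)"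

lemma mcoeff_0 [simp]: "mcoeff 0 M = 0"
  by (simp add: zero_mfps_def)

lemma mcoeff_add [simp]: "mcoeff (f + g) M = mcoeff f M + mcoeff g M"
  by (simp add: plus_mfps_def)

lemma mcoeff_diff [simp]: "mcoeff (f - g) M = mcoeff f M - mcoeff g M"
  by (simp add: minus_mfps_def)

lemma mcoeff_sum: "mcoeff (sum F I) M = (\<Sum>i\<in>I. mcoeff (F i) M)"
  by (induction I rule: infinite_finite_induct) auto

lemma mcoeff_mult: "mcoeff (f * g) M = (\<Sum>(A, B) | A + B = M. mcoeff f A * mcoeff g B)"
  by (simp add: times_mfps_def)

lemma mdeg_ge_0 [simp]: "mdeg_ge f 0"
  by (simp add: mdeg_ge_def)

lemma mdeg_ge_zero [simp]: "mdeg_ge 0 d"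
  by (simp add: mdeg_ge_def)

lemma mdeg_ge_mono: "mdeg_ge f d \<Longrightarrow> e \<le> d \<Longrightarrow> mdeg_ge f e"
  by (auto simp: mdeg_ge_def)

lemma mdeg_ge_diff: "mdeg_ge f d \<Longrightarrow> mdeg_ge g d \<Longrightarrow> mdeg_ge (f - g) d"
  by (auto simp: mdeg_ge_def)

lemma mdeg_ge_sum: "(\<And>i. i \<in> I \<Longrightarrow> mdeg_ge (F i) d) \<Longrightarrow> mdeg_ge (sum F I) d"
  by (auto simp: mdeg_ge_def mcoeff_sum intro!: sum.neutral)

lemma mdeg_ge_mult:
  assumes "mdeg_ge f d" "mdeg_ge g e"
  shows "mdeg_ge (f * g) (d + e)"
  unfolding mdeg_ge_def mcoeff_mult
proof (intro allI impI sum.neutral ballI, clarify)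
  fix A B :: "'a multiset"
  assume "size (A + B) < d + e"
  then have "size A < d \<or> size B < e" by auto
  then show "mcoeff f A * mcoeff g B = 0" using assms by (auto simp: mdeg_ge_def)
qed

lemma mdeg_ge_mult_left: "mdeg_ge f d \<Longrightarrow> mdeg_ge (f * g) d"
  using mdeg_ge_mult[of f d g 0] by simp

lemma mdeg_ge_mult_right: "mdeg_ge g d \<Longrightarrow> mdeg_ge (f * g) d"
  using mdeg_ge_mult[of f 0 g d] by simp

lemma mdeg_ge_power: "mdeg_ge f 1 \<Longrightarrow> mdeg_ge (f ^ k) k"
  using mdeg_ge_mult[of f 1] by (induction k) auto

lemma mdeg_ge_mvar: "mdeg_ge (mvar v) 1"
  by (auto simp: mdeg_ge_def mvar_def)

lemma mfps_eq_iff_mdeg_ge: "f = g \<longleftrightarrow> (\<forall>d. mdeg_ge (f - g) d)"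
proof
  assume "\<forall>d. mdeg_ge (f - g) d"
  then show "f = g" by (intro mfps_eqI) (force simp: mdeg_ge_def)
qed (simp add: mdeg_ge_def)

text \<open>The inverse of \<open>1 - t\<close> is a definite description, so it can be compared
  with truncations only after an explicit inverse has been exhibited.\<close>

lemma geometric_series_mfps:
  fixes t :: "('v, 'a :: comm_ring_1) mfps"
  assumes "mdeg_ge t 1"
  shows "mdeg_ge (1 / (1 - t) - (\<Sum>k\<le>K. t ^ k)) (Suc K)"
proof -
  \<comment> \<open>The sum of all powers \<open>t ^ k\<close>, cut off at the monomial
    \<open>M\<close> after \<open>k = size M\<close>, because higher powers have no term at
    \<open>M\<close>.\<close>
  define g where "g = Abs_mfps (\<lambda>M. \<Sum>k\<le>size M. mcoeff (t ^ k) M)"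
  have g: "mdeg_ge (g - (\<Sum>k\<le>K. t ^ k)) (Suc K)" for K
    unfolding mdeg_ge_def
  proof (intro allI impI)
    fix M :: "'v multiset" assume M: "size M < Suc K"
    have "(\<Sum>k\<le>K. mcoeff (t ^ k) M) = (\<Sum>k\<le>size M. mcoeff (t ^ k) M)"
      using M mdeg_ge_power[OF assms] by (intro sum.mono_neutral_right) (auto simp: mdeg_ge_def)
    then show "mcoeff (g - (\<Sum>k\<le>K. t ^ k)) M = 0" by (simp add: g_def mcoeff_sum)
  qed
  have "mdeg_ge ((1 - t) * g - 1) (Suc K)" for K
  proof -
    \<comment> \<open>\<open>1 - t\<close> times the finite geometric sum is
      \<open>1 - t ^ Suc K\<close>; both remaining error terms have order at least
      \<open>Suc K\<close>.\<close>
    have "(1 - t) * g - 1 = (1 - t) * (g - (\<Sum>k\<le>K. t ^ k)) - t ^ Suc K"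
      using sum_gp_basic[of t K] by (simp add: right_diff_distrib)
    then show ?thesis
      using mdeg_ge_diff[OF mdeg_ge_mult_right[OF g, of "1 - t" K] mdeg_ge_power[OF assms, of "Suc K"]]
      by simp
  qed
  then have "(1 - t) * g = 1"
    unfolding mfps_eq_iff_mdeg_ge by (meson mdeg_ge_mono lessI less_imp_le)
  then have "1 / (1 - t) = g"
    by (simp add: divide_mfps_def mfps_inverse_unique)
  then show ?thesis using g by simp
qed

section \<open>Rules for formal sums\<close>

lemma has_formal_sumI:
  assumes "\<And>M. \<exists>K. finite K \<and> K \<subseteq> I \<and> (\<forall>i\<in>I - K. mcoeff (F i) M = 0) \<and>
             (\<Sum>i\<in>K. mcoeff (F i) M) = mcoeff S M"
  shows "has_formal_sum F I S"
  unfolding has_formal_sum_def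
proof
  fix M
  obtain K where K: "finite K" "K \<subseteq> I" "\<forall>i\<in>I - K. mcoeff (F i) M = 0"
    "(\<Sum>i\<in>K. mcoeff (F i) M) = mcoeff S M" using assms by blast
  have sub: "{i \<in> I. mcoeff (F i) M \<noteq> 0} \<subseteq> K" using K by auto
  then have "(\<Sum>i\<in>{i \<in> I. mcoeff (F i) M \<noteq> 0}. mcoeff (F i) M) = (\<Sum>i\<in>K. mcoeff (F i) M)"
    using K by (intro sum.mono_neutral_left) auto
  then show "finite {i \<in> I. mcoeff (F i) M \<noteq> 0} \<and>
      (\<Sum>i\<in>{i \<in> I. mcoeff (F i) M \<noteq> 0}. mcoeff (F i) M) = mcoeff S M"
    using K sub finite_subset by auto
qed

lemma has_formal_sum_finite:
  assumes "has_formal_sum F I S"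
  shows "finite {i \<in> I. mcoeff (F i) M \<noteq> 0}"
  using assms by (simp add: has_formal_sum_def)

lemma has_formal_sum_superset:
  assumes "has_formal_sum F I S" "finite K" "K \<subseteq> I" "{i \<in> I. mcoeff (F i) M \<noteq> 0} \<subseteq> K"
  shows "(\<Sum>i\<in>K. mcoeff (F i) M) = mcoeff S M"
proof -
  have "(\<Sum>i\<in>K. mcoeff (F i) M) = (\<Sum>i\<in>{i \<in> I. mcoeff (F i) M \<noteq> 0}. mcoeff (F i) M)"
    using assms by (intro sum.mono_neutral_right) auto
  then show ?thesis using assms(1) by (simp add: has_formal_sum_def)
qed

text \<open>The coefficient at \<open>M\<close> is visible modulo order \<open>Suc (size M)\<close>,
  so finite partial sums that approximate \<open>S\<close> to every order suffice.\<close>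

lemma has_formal_sum_degree:
  fixes S :: "('v, 'a :: comm_ring_1) mfps"
  assumes "\<And>d. \<exists>K. finite K \<and> K \<subseteq> I \<and> (\<forall>i\<in>I - K. mdeg_ge (F i) d) \<and>
             mdeg_ge (S - (\<Sum>i\<in>K. F i)) d"
  shows "has_formal_sum F I S"
proof (rule has_formal_sumI)
  fix M :: "'v multiset"
  from assms[of "Suc (size M)"] obtain K where "finite K" "K \<subseteq> I"
    "\<forall>i\<in>I - K. mdeg_ge (F i) (Suc (size M))" "mdeg_ge (S - (\<Sum>i\<in>K. F i)) (Suc (size M))"
    by blast
  then show "\<exists>K. finite K \<and> K \<subseteq> I \<and> (\<forall>i\<in>I - K. mcoeff (F i) M = 0) \<and>
             (\<Sum>i\<in>K. mcoeff (F i) M) = mcoeff S M"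
    by (intro exI[of _ K]) (auto simp: mdeg_ge_def mcoeff_sum)
qed

lemma has_formal_sum_finite_support:
  assumes "finite K" "K \<subseteq> I" "\<And>i. i \<in> I - K \<Longrightarrow> F i = 0"
  shows "has_formal_sum F I (\<Sum>i\<in>K. F i)"
  using assms by (intro has_formal_sumI exI[of _ K]) (auto simp: mcoeff_sum)

lemma has_formal_sum_cmult:
  fixes S :: "('v, 'a :: comm_ring_1) mfps"
  assumes "has_formal_sum F I S"
  shows "has_formal_sum (\<lambda>i. c * F i) I (c * S)"
proof (rule has_formal_sumI)
  fix M :: "'v multiset"
  \<comment> \<open>The coefficient of \<open>c * F i\<close> at \<open>M\<close> involves
    \<open>F i\<close> only at the finitely many submultisets of \<open>M\<close>; the union of the
    supports there serves all of them at once.\<close>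
  define K where "K = (\<Union>B\<in>{B. B \<subseteq># M}. {i \<in> I. mcoeff (F i) B \<noteq> 0})"
  have fin: "finite K" "K \<subseteq> I"
    using has_formal_sum_finite[OF assms] by (auto simp: K_def finite_submultisets)
  have K: "mcoeff (F i) B = 0" if "i \<in> I - K" "B \<subseteq># M" for i B
    using that by (auto simp: K_def)
  have "mcoeff (c * F i) M = 0" if "i \<in> I - K" for i
    unfolding mcoeff_mult using K[OF that] by (intro sum.neutral) auto
  moreover have "(\<Sum>i\<in>K. mcoeff (c * F i) M) = mcoeff (c * S) M"
  proof -
    have "(\<Sum>i\<in>K. mcoeff (c * F i) M) = mcoeff (c * sum F K) M"
      by (simp add: mcoeff_sum sum_distrib_left)
    also have "\<dots> = mcoeff (c * S) M"
      unfolding mcoeff_mult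
    proof (intro sum.cong refl, clarify)
      fix A B assume "M = A + B"
      then have "mcoeff (sum F K) B = mcoeff S B"
        unfolding mcoeff_sum using K fin
        by (intro has_formal_sum_superset[OF assms]) fastforce+
      then show "mcoeff c A * mcoeff (sum F K) B = mcoeff c A * mcoeff S B" by simp
    qed
    finally show ?thesis .
  qed
  ultimately show "\<exists>K. finite K \<and> K \<subseteq> I \<and> (\<forall>i\<in>I - K. mcoeff (c * F i) M = 0) \<and>
      (\<Sum>i\<in>K. mcoeff (c * F i) M) = mcoeff (c * S) M"
    using fin by blast
qed

lemma has_formal_sum_sum:
  fixes S :: "'j \<Rightarrow> ('v, 'a :: comm_ring_1) mfps"
  assumes "finite J" "\<And>j. j \<in> J \<Longrightarrow> has_formal_sum (F j) I (S j)"
  shows "has_formal_sum (\<lambda>i. \<Sum>j\<in>J. F j i) I (\<Sum>j\<in>J. S j)"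
proof (rule has_formal_sumI)
  fix M :: "'v multiset"
  define K where "K = (\<Union>j\<in>J. {i \<in> I. mcoeff (F j i) M \<noteq> 0})"
  have fin: "finite K" "K \<subseteq> I"
    using has_formal_sum_finite[OF assms(2)] assms(1) by (auto simp: K_def)
  have "(\<Sum>i\<in>K. mcoeff (\<Sum>j\<in>J. F j i) M) = (\<Sum>j\<in>J. \<Sum>i\<in>K. mcoeff (F j i) M)"
    unfolding mcoeff_sum by (rule sum.swap)
  also have "\<dots> = mcoeff (\<Sum>j\<in>J. S j) M"
    unfolding mcoeff_sum using fin
    by (intro sum.cong refl has_formal_sum_superset[OF assms(2)]) (auto simp: K_def)
  finally show "\<exists>K. finite K \<and> K \<subseteq> I \<and> (\<forall>i\<in>I - K. mcoeff (\<Sum>j\<in>J. F j i) M = 0) \<and>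
      (\<Sum>i\<in>K. mcoeff (\<Sum>j\<in>J. F j i) M) = mcoeff (\<Sum>j\<in>J. S j) M"
    using fin by (intro exI[of _ K]) (auto simp: K_def mcoeff_sum intro!: sum.neutral)
qed

text \<open>Fubini for formal sums. Finiteness of the joint support is a separate hypothesis because
  cancellation in the inner sums could hide infinitely many nonzero terms.\<close>

lemma has_formal_sum_swap:
  fixes T :: "('v, 'a :: comm_ring_1) mfps"
  assumes fin: "\<And>M. finite {(i, j). i \<in> I \<and> j \<in> J \<and> mcoeff (F i j) M \<noteq> 0}"
    and S: "\<And>i. i \<in> I \<Longrightarrow> has_formal_sum (F i) J (S i)"
    and R: "\<And>j. j \<in> J \<Longrightarrow> has_formal_sum (\<lambda>i. F i j) I (R j)"
    and T: "has_formal_sum R J T"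
  shows "has_formal_sum S I T"
proof (rule has_formal_sumI)
  fix M :: "'v multiset"
  define P where "P = {(i, j). i \<in> I \<and> j \<in> J \<and> mcoeff (F i j) M \<noteq> 0}"
  \<comment> \<open>The projections of the joint support span a finite rectangle outside which every
    term vanishes at \<open>M\<close>; there the exchange is one of finite sums.\<close>
  define A B where "A = fst ` P" and "B = snd ` P"
  have AB: "finite A" "finite B" "A \<subseteq> I" "B \<subseteq> J"
    using fin[of M] by (auto simp: A_def B_def P_def)
  have zero: "mcoeff (F i j) M = 0" if "i \<in> I" "j \<in> J" "i \<notin> A \<or> j \<notin> B" for i j
    using that by (force simp: A_def B_def P_def)
  have S': "mcoeff (S i) M = (\<Sum>j\<in>B. mcoeff (F i j) M)" if "i \<in> I" for i
    using AB zero that by (intro has_formal_sum_superset[OF S, symmetric]) auto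
  have R': "mcoeff (R j) M = (\<Sum>i\<in>A. mcoeff (F i j) M)" if "j \<in> J" for j
    using AB zero that by (intro has_formal_sum_superset[OF R, symmetric]) auto
  have "(\<Sum>i\<in>A. mcoeff (S i) M) = (\<Sum>i\<in>A. \<Sum>j\<in>B. mcoeff (F i j) M)"
    using AB S' by (intro sum.cong) auto
  also have "\<dots> = (\<Sum>j\<in>B. \<Sum>i\<in>A. mcoeff (F i j) M)" by (rule sum.swap)
  also have "\<dots> = (\<Sum>j\<in>B. mcoeff (R j) M)"
    using AB R' by (intro sum.cong) auto
  also have "\<dots> = mcoeff T M"
  proof (rule has_formal_sum_superset[OF T \<open>finite B\<close> \<open>B \<subseteq> J\<close>])
    show "{j \<in> J. mcoeff (R j) M \<noteq> 0} \<subseteq> B"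
    proof clarify
      fix j assume j: "j \<in> J" "mcoeff (R j) M \<noteq> 0"
      have "mcoeff (R j) M = 0" if "j \<notin> B"
        unfolding R'[OF j(1)] using that zero j AB by (intro sum.neutral) auto
      with j show "j \<in> B" by blast
    qed
  qed
  finally have "(\<Sum>i\<in>A. mcoeff (S i) M) = mcoeff T M" .
  moreover have "mcoeff (S i) M = 0" if "i \<in> I - A" for i
    using S'[of i] zero[of i] that AB by (auto intro!: sum.neutral)
  ultimately show "\<exists>K. finite K \<and> K \<subseteq> I \<and> (\<forall>i\<in>I - K. mcoeff (S i) M = 0) \<and>
      (\<Sum>i\<in>K. mcoeff (S i) M) = mcoeff T M"
    using AB by blast
qed

section \<open>Partition functions as sums over chains of partitions\<close>

text \<open>The entry of the one-row transfer matrix from \<mu> to \<open>l\<close>. The value 0 off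
  \<open>\<mu> \<le> l\<close> guards against truncated subtraction, which would produce labels
  belonging to no row.\<close>

definition row_weight ::
    "(nat \<Rightarrow> nat \<Rightarrow> nat \<Rightarrow> nat \<Rightarrow> nat \<Rightarrow> 'r :: comm_ring_1) \<Rightarrow> (nat \<Rightarrow> nat) \<Rightarrow> (nat \<Rightarrow> nat) \<Rightarrow> 'r" where
  "row_weight W \<mu> l = (if \<mu> \<le> l then
     let w = (\<lambda>s. W s (l s - \<mu> s) (\<mu> s - \<mu> (s + 1)) (l (s + 1) - \<mu> (s + 1)) (l s - l (s + 1)))
     in \<Prod>s \<in> {s. s \<ge> 1 \<and> w s \<noteq> 1}. w s else 0)"

section \<open>Partitions and finite sets of them\<close>

lemma partitions_zero [simp]: "(\<lambda>_. 0) \<in> partitions"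
  by (simp add: partitions_def)

lemma partitions_0: "l \<in> partitions \<Longrightarrow> l 0 = 0"
  by (simp add: partitions_def)

lemma partitions_step: "l \<in> partitions \<Longrightarrow> s \<ge> 1 \<Longrightarrow> l (Suc s) \<le> l s"
  by (simp add: partitions_def)

lemma partitions_antimono:
  assumes "l \<in> partitions" "1 \<le> s" "s \<le> t"
  shows "l t \<le> l s"
  using assms(3)
proof (induction rule: dec_induct)
  case (step k)
  then show ?case using partitions_step[OF assms(1), of k] assms(2) by simp
qed simp

lemma partitions_eventually_zero:
  assumes "l \<in> partitions"
  obtains L where "L \<ge> 1" "\<And>s. s \<ge> L \<Longrightarrow> l s = 0"
proof -
  have "finite {s. l s \<noteq> 0}" using assms by (simp add: partitions_def)
  then obtain L where "\<And>s. l s \<noteq> 0 \<Longrightarrow> s < L"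
    unfolding finite_nat_set_iff_bounded by blast
  then show thesis using that[of "Suc L"] by (metis Suc_leD le_add1 not_less plus_1_eq_Suc)
qed

lemma finite_partitions_box: "finite {l \<in> partitions. l 1 \<le> d \<and> (\<forall>s>L. l s = 0)}"
proof (rule finite_subset)
  show "finite {f. \<forall>s. (s \<in> {0..L} \<longrightarrow> f s \<in> {0..d}) \<and> (s \<notin> {0..L} \<longrightarrow> f s = (0 :: nat))}"
    by (rule finite_set_of_finite_funs) auto
  show "{l \<in> partitions. l 1 \<le> d \<and> (\<forall>s>L. l s = 0)} \<subseteq>
    {f. \<forall>s. (s \<in> {0..L} \<longrightarrow> f s \<in> {0..d}) \<and> (s \<notin> {0..L} \<longrightarrow> f s = (0 :: nat))}"
  proof clarify
    fix l s assume l: "l \<in> partitions" "l 1 \<le> d" "\<forall>s>L. l s = 0"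
    show "(s \<in> {0..L} \<longrightarrow> l s \<in> {0..d}) \<and> (s \<notin> {0..L} \<longrightarrow> l s = 0)"
      using l partitions_antimono[OF l(1), of 1 s] partitions_0[OF l(1)]
      by (cases "s = 0") auto
  qed
qed

lemma finite_partitions_below:
  assumes "l \<in> partitions"
  shows "finite {\<mu> \<in> partitions. \<mu> \<le> l}"
proof -
  obtain L where L: "\<And>s. s \<ge> L \<Longrightarrow> l s = 0" using partitions_eventually_zero[OF assms] by metis
  have "{\<mu> \<in> partitions. \<mu> \<le> l} \<subseteq> {\<mu> \<in> partitions. \<mu> 1 \<le> l 1 \<and> (\<forall>s>L. \<mu> s = 0)}"
    by (auto simp: le_fun_def) (metis L bot_nat_0.extremum_uniqueI less_imp_le)
  then show ?thesis using finite_partitions_box finite_subset by blast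
qed

lemma partition_le_zero: "\<mu> \<le> (\<lambda>_. 0 :: nat) \<longleftrightarrow> \<mu> = (\<lambda>_. 0)"
  by (auto simp: le_fun_def)

lemma row_weight_eq_0: "\<not> \<mu> \<le> l \<Longrightarrow> row_weight W \<mu> l = 0"
  by (simp add: row_weight_def)

text \<open>All vertices right of \<open>L\<close> are empty. A fixed index range, in place of one
  that depends on the weights, lets products of two rows be merged factor by factor.\<close>

lemma row_weight_eq_prod:
  assumes "\<mu> \<le> l" "\<And>s. s > L \<Longrightarrow> l s = 0" "\<And>s. W s 0 0 0 0 = 1"
  shows "row_weight W \<mu> l =
    (\<Prod>s=1..L. W s (l s - \<mu> s) (\<mu> s - \<mu> (s + 1)) (l (s + 1) - \<mu> (s + 1)) (l s - l (s + 1)))"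
proof -
  have \<mu>: "\<mu> s = 0" if "s > L" for s
    using assms(1,2) that by (metis le_fun_def bot_nat_0.extremum_uniqueI)
  have "s \<le> L" if "W s (l s - \<mu> s) (\<mu> s - \<mu> (s + 1)) (l (s + 1) - \<mu> (s + 1)) (l s - l (s + 1)) \<noteq> 1" for s
    using that assms \<mu> by (metis Suc_eq_plus1 diff_self_eq_0 less_SucI not_le)
  then show ?thesis
    unfolding row_weight_def Let_def using assms(1)
    by (auto intro!: prod.mono_neutral_left)
qed

section \<open>Adding and removing the top row\<close>

lemma labelings_conservation:
  assumes "(h, v) \<in> labelings N l" "k \<in> {1..N}" "s \<ge> 1"
  shows "h k s + v (k - 1) s = h k (s + 1) + v k s"
proof -
  have "\<forall>k\<in>{1..N}. \<forall>s\<ge>1. h k s + v (k - 1) s = h k (s + 1) + v k s"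
    using assms(1) unfolding labelings_def by blast
  then show ?thesis using assms by blast
qed

lemma labelings_eventually_zero:
  assumes "(h, v) \<in> labelings N l" "k \<in> {1..N}"
  shows "\<exists>S. \<forall>s\<ge>S. h k (s + 1) = 0"
proof -
  have "\<forall>k\<in>{1..N}. \<exists>S. \<forall>s\<ge>S. h k (s + 1) = 0"
    using assms(1) unfolding labelings_def by blast
  then show ?thesis using assms by blast
qed

text \<open>Without rows the top boundary is the bottom boundary, so consecutive parts of
  \<open>l\<close> agree; since \<open>l\<close> is eventually 0, descending induction on the site
  makes all parts 0.\<close>

lemma labelings_0:
  assumes "l \<in> partitions"
  shows "labelings 0 l = (if l = (\<lambda>_. 0) then {(\<lambda>_ _. 0, \<lambda>_ _. 0)} else {})"
proof -
  have zero: "l = (\<lambda>_. 0)" if hv: "(h, v) \<in> labelings 0 l" for h v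
  proof -
    obtain L where L: "L \<ge> 1" "\<And>s. s \<ge> L \<Longrightarrow> l s = 0"
      using partitions_eventually_zero[OF assms] by metis
    have eq: "l s \<le> l (s + 1)" if "s \<ge> 1" for s
      using hv that by (auto simp: labelings_def)
    have "l s = 0" if s: "1 \<le> s" "s \<le> L" for s
      using s(2,1)
    proof (induction rule: inc_induct)
      case base
      then show ?case using L by simp
    next
      case (step k)
      then show ?case using eq[of k] by simp
    qed
    then have "l s = 0" for s
      using L(2) partitions_0[OF assms] by (metis le_cases less_one not_le)
    then show ?thesis by auto
  qed
  have uniq: "(h, v) = (\<lambda>_ _. 0, \<lambda>_ _. 0)" if "(h, v) \<in> labelings 0 l" for h v
  proof -
    have "h k s = 0 \<and> v k s = 0" for k s
      using that by (cases "k = 0"; cases "s = 0") (auto simp: labelings_def)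
    then show ?thesis by auto
  qed
  show ?thesis
  proof (cases "l = (\<lambda>_. 0)")
    case True
    have "(\<lambda>_ _. 0, \<lambda>_ _. 0) \<in> labelings 0 l"
      by (simp add: labelings_def True)
    then have "labelings 0 l = {(\<lambda>_ _. 0, \<lambda>_ _. 0)}"
      using uniq by fast
    then show ?thesis using True by simp
  next
    case False
    then have "labelings 0 l = {}" using zero by fast
    then show ?thesis using False by (simp only: if_False)
  qed
qed

lemma partition_function_0:
  "l \<in> partitions \<Longrightarrow> partition_function 0 W l = (if l = (\<lambda>_. 0) then 1 else 0)"
  by (simp add: partition_function_def labelings_0)

text \<open>Subtracting the horizontal labels of the top row from \<open>l\<close> gives the
  partition that bounds the lower rows. The bound \<open>h (Suc N) s \<le> l s\<close> makes this
  subtraction exact.\<close>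

lemma labelings_Suc_down:
  assumes l: "l \<in> partitions" and hv: "(h, v) \<in> labelings (Suc N) l"
  defines "\<mu> \<equiv> \<lambda>s. l s - h (Suc N) s"
  shows "\<mu> \<in> partitions" "\<mu> \<le> l"
    "(h(Suc N := \<lambda>_. 0), v(Suc N := \<lambda>_. 0)) \<in> labelings N \<mu>"
    "\<And>s. h (Suc N) s = l s - \<mu> s" "\<And>s. s \<ge> 1 \<Longrightarrow> v N s = \<mu> s - \<mu> (s + 1)"
proof -
  have hl: "h (Suc N) s \<le> l s" for s using labelings_bounded(1)[OF l hv] .
  have ls: "l (Suc s) \<le> l s" if "s \<ge> 1" for s using partitions_step[OF l that] .
  have top: "v (Suc N) s = l s - l (Suc s)" if "s \<ge> 1" for s
    using hv that by (auto simp: labelings_def)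
  have cons: "h (Suc N) s + v N s = h (Suc N) (Suc s) + v (Suc N) s" if "s \<ge> 1" for s
    using labelings_conservation[OF hv, of "Suc N" s] that by simp
  show h: "h (Suc N) s = l s - \<mu> s" for s using hl[of s] by (simp add: \<mu>_def)
  \<comment> \<open>Conservation in the top row, with \<open>v (Suc N) s\<close> replaced by the
    difference of parts of \<open>l\<close>.\<close>
  have key: "\<mu> s = v N s + \<mu> (Suc s)" if "s \<ge> 1" for s
    using cons[OF that] top[OF that] ls[OF that] hl[of s] hl[of "Suc s"] by (simp add: \<mu>_def)
  show v: "v N s = \<mu> s - \<mu> (s + 1)" if "s \<ge> 1" for s using key[OF that] by simp
  show "\<mu> \<le> l" by (simp add: \<mu>_def le_fun_def)
  show "\<mu> \<in> partitions"
    unfolding partitions_def mem_Collect_eq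
  proof (intro conjI allI impI)
    show "\<mu> 0 = 0" using partitions_0[OF l] by (simp add: \<mu>_def)
    show "\<mu> (s + 1) \<le> \<mu> s" if "s \<ge> 1" for s
      by (simp add: key[OF that])
    have "{s. \<mu> s \<noteq> 0} \<subseteq> {s. l s \<noteq> 0}" by (auto simp: \<mu>_def)
    then show "finite {s. \<mu> s \<noteq> 0}"
      using l finite_subset by (auto simp: partitions_def)
  qed
  show "(h(Suc N := \<lambda>_. 0), v(Suc N := \<lambda>_. 0)) \<in> labelings N \<mu>"
    unfolding labelings_def mem_Collect_eq prod.case
  proof (intro conjI allI ballI impI)
    fix k s
    show "(h(Suc N := \<lambda>_. 0)) k s = 0" if "k \<notin> {1..N} \<or> s = 0"
      using hv that by (cases "k = Suc N") (auto simp: labelings_def le_Suc_eq)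
    show "(v(Suc N := \<lambda>_. 0)) k s = 0" if "N < k \<or> s = 0"
      using hv that by (cases "k = Suc N") (auto simp: labelings_def le_Suc_eq)
    show "(v(Suc N := \<lambda>_. 0)) 0 s = 0" if "1 \<le> s"
      using hv that by (simp add: labelings_def)
    show "(v(Suc N := \<lambda>_. 0)) N s = \<mu> s - \<mu> (s + 1)" if "1 \<le> s"
      using v that by simp
  next
    fix k s :: nat assume k: "k \<in> {1..N}"
    then have k': "k \<in> {1..Suc N}" "k \<noteq> Suc N" "k - 1 \<noteq> Suc N" by auto
    show "(h(Suc N := \<lambda>_. 0)) k s + (v(Suc N := \<lambda>_. 0)) (k - 1) s =
        (h(Suc N := \<lambda>_. 0)) k (s + 1) + (v(Suc N := \<lambda>_. 0)) k s" if "1 \<le> s"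
      using labelings_conservation[OF hv k'(1) that] k' by simp
    show "\<exists>S. \<forall>s\<ge>S. (h(Suc N := \<lambda>_. 0)) k (s + 1) = 0"
      using labelings_eventually_zero[OF hv k'(1)] k' by simp
  qed
qed

text \<open>The inverse construction. Conservation holds in the new row because both sides equal
  \<open>l s - \<mu> (s + 1)\<close>. The entry of \<open>v\<close> at site 0 labels no edge and
  stays 0.\<close>

lemma labelings_Suc_up:
  assumes l: "l \<in> partitions" and \<mu>: "\<mu> \<in> partitions" "\<mu> \<le> l" and hv: "(h, v) \<in> labelings N \<mu>"
  shows "(h(Suc N := \<lambda>s. l s - \<mu> s), v(Suc N := \<lambda>s. if s = 0 then 0 else l s - l (s + 1)))
           \<in> labelings (Suc N) l"
proof -
  have le: "\<mu> s \<le> l s" for s using \<mu> by (simp add: le_fun_def)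
  have v: "v N s = \<mu> s - \<mu> (Suc s)" if "s \<ge> 1" for s
    using hv that by (auto simp: labelings_def)
  have cons: "l s - \<mu> s + v N s = l (Suc s) - \<mu> (Suc s) + (l s - l (Suc s))" if "s \<ge> 1" for s
    using le[of s] le[of "Suc s"] partitions_step[OF l that] partitions_step[OF \<mu>(1) that] v[OF that]
    by simp
  obtain L where "\<And>s. s \<ge> L \<Longrightarrow> l s = 0" using partitions_eventually_zero[OF l] by metis
  then have ev: "\<exists>S. \<forall>s\<ge>S. l (Suc s) - \<mu> (Suc s) = 0" by (metis diff_0_eq_0 le_SucI)
  show ?thesis
    (is "(?h, ?v) \<in> _")
    unfolding labelings_def mem_Collect_eq prod.case
  proof (intro conjI allI ballI impI)
    fix k s
    show "?h k s = 0" if "k \<notin> {1..Suc N} \<or> s = 0"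
      using hv that partitions_0[OF l] by (auto simp: labelings_def)
    show "?v k s = 0" if "Suc N < k \<or> s = 0"
      using hv that by (auto simp: labelings_def)
    show "?v 0 s = 0" if "1 \<le> s"
      using hv that by (simp add: labelings_def)
    show "?v (Suc N) s = l s - l (s + 1)" if "1 \<le> s"
      using that by simp
  next
    fix k s :: nat assume k: "k \<in> {1..Suc N}"
    show "?h k s + ?v (k - 1) s = ?h k (s + 1) + ?v k s" if "1 \<le> s"
    proof (cases "k = Suc N")
      case True
      then show ?thesis using cons[OF that] that by simp
    next
      case False
      then have "k \<in> {1..N}" "k \<noteq> Suc N" "k - 1 \<noteq> Suc N" using k by auto
      then show ?thesis
        using labelings_conservation[OF hv _ that, of k] by simp
    qed
    show "\<exists>S. \<forall>s\<ge>S. ?h k (s + 1) = 0"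
    proof (cases "k = Suc N")
      case True
      then show ?thesis using ev by simp
    next
      case False
      then have "k \<in> {1..N}" "k \<noteq> Suc N" using k by auto
      then show ?thesis
        using labelings_eventually_zero[OF hv, of k] by simp
    qed
  qed
qed

text \<open>The transfer-matrix recursion: cutting off the top row is a bijection onto pairs of an
  intermediate partition \<mu> and a labeling of the lower rows with top boundary \<mu>.\<close>

lemma partition_function_Suc:
  assumes l: "l \<in> partitions"
  shows "partition_function (Suc N) W l =
    (\<Sum>\<mu>\<in>{\<mu> \<in> partitions. \<mu> \<le> l}. partition_function N W \<mu> * row_weight (W (Suc N)) \<mu> l)"
proof -
  define row where "row h v k = (let w = (\<lambda>s. W k s (h k s) (v (k - 1) s) (h k (s + 1)) (v k s))
        in \<Prod>s \<in> {s. s \<ge> 1 \<and> w s \<noteq> 1}. w s)" for h v :: "nat \<Rightarrow> nat \<Rightarrow> nat" and k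
  define down :: "(nat \<Rightarrow> nat \<Rightarrow> nat) \<times> (nat \<Rightarrow> nat \<Rightarrow> nat) \<Rightarrow> _" where
    "down = (\<lambda>(h, v). (\<lambda>s. l s - h (Suc N) s, h(Suc N := \<lambda>_. 0), v(Suc N := \<lambda>_. 0)))"
  define up where "up = (\<lambda>(\<mu>, h, v). (h(Suc N := \<lambda>s. l s - \<mu> s),
    v(Suc N := \<lambda>s. if s = 0 then 0 else l s - l (s + 1))))"
  have pf: "partition_function M W \<mu> = (\<Sum>(h, v)\<in>labelings M \<mu>. \<Prod>k=1..M. row h v k)" for M \<mu>
    by (simp add: partition_function_def row_def)
  \<comment> \<open>A row sees only its own labels and the vertical labels just below it, so
    altering row \<open>Suc N\<close> does not affect the weights of rows
    \<open>1..N\<close>.\<close>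
  have row_cong: "row h v k = row h' v' k"
    if "h k = h' k" "v k = v' k" "v (k - 1) = v' (k - 1)" for h v h' v' k
    using that by (simp add: row_def)
  have top: "row h v (Suc N) = row_weight (W (Suc N)) \<mu> l"
    if "\<mu> \<le> l" "\<And>s. s \<ge> 1 \<Longrightarrow> h (Suc N) s = l s - \<mu> s" "\<And>s. s \<ge> 1 \<Longrightarrow> v N s = \<mu> s - \<mu> (s + 1)"
      "\<And>s. s \<ge> 1 \<Longrightarrow> v (Suc N) s = l s - l (s + 1)" for h v \<mu>
    unfolding row_def row_weight_def Let_def using that
    by (auto intro!: prod.cong)
  have "(\<Sum>\<mu>\<in>{\<mu> \<in> partitions. \<mu> \<le> l}. partition_function N W \<mu> * row_weight (W (Suc N)) \<mu> l) =
    (\<Sum>(\<mu>, h, v)\<in>Sigma {\<mu> \<in> partitions. \<mu> \<le> l} (labelings N).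
       (\<Prod>k=1..N. row h v k) * row_weight (W (Suc N)) \<mu> l)"
    unfolding pf sum_distrib_right
    by (subst sum.Sigma) (auto simp: finite_partitions_below[OF l] finite_labelings split_def)
  also have "\<dots> = (\<Sum>(h, v)\<in>labelings (Suc N) l. \<Prod>k=1..Suc N. row h v k)"
  proof (rule sum.reindex_bij_witness[where i = down and j = up])
    fix a assume "a \<in> Sigma {\<mu> \<in> partitions. \<mu> \<le> l} (labelings N)"
    then obtain \<mu> h v where a: "a = (\<mu>, h, v)" and \<mu>: "\<mu> \<in> partitions" "\<mu> \<le> l"
      and hv: "(h, v) \<in> labelings N \<mu>" by auto
    have "(\<lambda>s. l s - (l s - \<mu> s)) = \<mu>" using \<mu>(2) by (simp add: le_fun_def)
    moreover have "h(Suc N := \<lambda>_. 0) = h" "v(Suc N := \<lambda>_. 0) = v"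
      using hv by (auto simp: labelings_def fun_eq_iff)
    ultimately show "down (up a) = a"
      by (simp add: up_def down_def a)
    show "up a \<in> labelings (Suc N) l"
      using labelings_Suc_up[OF l \<mu> hv] by (simp add: up_def a)
    obtain h' v' where up: "up a = (h', v')" by (cases "up a")
    then have h'v': "h' = h(Suc N := \<lambda>s. l s - \<mu> s)"
        "v' = v(Suc N := \<lambda>s. if s = 0 then 0 else l s - l (s + 1))"
      by (auto simp: up_def a)
    have "v N s = \<mu> s - \<mu> (s + 1)" if "s \<ge> 1" for s
      using hv that by (auto simp: labelings_def)
    then have "row h' v' (Suc N) = row_weight (W (Suc N)) \<mu> l"
      using \<mu> by (intro top) (auto simp: h'v')
    moreover have "row h' v' k = row h v k" if "k \<in> {1..N}" for k
      using that by (intro row_cong) (auto simp: h'v')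
    ultimately show "(case up a of (h, v) \<Rightarrow> \<Prod>k=1..Suc N. row h v k) =
        (case a of (\<mu>, h, v) \<Rightarrow> (\<Prod>k=1..N. row h v k) * row_weight (W (Suc N)) \<mu> l)"
      unfolding up unfolding a by simp
  next
    fix a assume "a \<in> labelings (Suc N) l"
    then obtain h v where a: "a = (h, v)" and hv: "(h, v) \<in> labelings (Suc N) l"
      by (cases a) auto
    note dn = labelings_Suc_down[OF l hv]
    have "(\<lambda>s. if s = 0 then 0 else l s - l (s + 1)) = v (Suc N)"
      using hv by (auto simp: labelings_def fun_eq_iff)
    moreover have "(\<lambda>s. l s - (l s - h (Suc N) s)) = h (Suc N)"
      using dn(4) by auto
    ultimately show "up (down a) = a"
      by (simp add: up_def down_def a)
    show "down a \<in> Sigma {\<mu> \<in> partitions. \<mu> \<le> l} (labelings N)"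
      using dn(1-3) by (simp add: down_def a)
  qed
  finally show ?thesis unfolding pf[symmetric] by simp
qed

section \<open>The one-row Cauchy identity\<close>

text \<open>\<open>a ^ (p - k) * (1 - a)\<close> is a difference of consecutive powers; the endpoint
  \<open>p = n\<close>, which lacks the factor \<open>1 - a\<close>, supplies the missing
  \<open>a ^ (n - k)\<close>.\<close>

lemma telescope_up:
  fixes a :: "'r :: comm_ring_1"
  assumes "k \<le> n"
  shows "(\<Sum>p=k..n. a ^ (p - k) * (if p < n then 1 - a else 1)) = 1"
proof -
  have "(\<Sum>p=k..n. a ^ (p - k) * (if p < n then 1 - a else 1)) =
        (\<Sum>p=k..<n. a ^ (p - k) * (1 - a)) + a ^ (n - k)"
    using assms by (simp add: atLeastLessThanSuc_atLeastAtMost[symmetric])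
  also have "(\<Sum>p=k..<n. a ^ (p - k) * (1 - a)) = 1 - a ^ (n - k)"
    using assms
  proof (induction n rule: dec_induct)
    case (step n)
    then show ?case by (simp add: Suc_diff_le algebra_simps)
  qed simp
  finally show ?thesis by simp
qed

text \<open>The mirror image of \<open>telescope_up\<close>, for sums over a part of the lower
  partition, where the exceptional endpoint is the smallest index.\<close>

lemma telescope_down:
  fixes a :: "'r :: comm_ring_1"
  assumes "k \<le> n"
  shows "(\<Sum>q=k..n. a ^ (n - q) * (if k < q then 1 - a else 1)) = 1"
proof -
  have "(\<Sum>q=k..n. a ^ (n - q) * (if k < q then 1 - a else 1)) =
        (\<Sum>p=k..n. a ^ (p - k) * (if p < n then 1 - a else 1))"
    by (rule sum.reindex_bij_witness[where i = "\<lambda>p. k + n - p" and j = "\<lambda>p. k + n - p"]) auto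
  then show ?thesis using telescope_up[OF assms] by simp
qed

text \<open>The core of \<open>site_identity\<close>, with a common lower bound \<open>j\<close>.
  The left side is first brought to the range \<open>{j..min \<mu> \<nu>}\<close> and then
  reflected.\<close>

lemma site_identity_aux:
  fixes a b :: "'r :: comm_ring_1"
  assumes "j \<le> \<mu>" "j \<le> \<nu>"
  shows "(\<Sum>p=j..\<mu>. (a * b) ^ (p - j) * a ^ (max \<mu> \<nu> - \<mu>) * b ^ (max \<mu> \<nu> - max \<nu> p) *
            (if p < \<mu> then 1 - a else 1)) =
         (\<Sum>q=j..min \<mu> \<nu>. b ^ (\<mu> - q) * a ^ (\<nu> - q) * (if j < q then 1 - a else 1))"
    (is "sum ?f _ = sum ?g _")
proof -
  let ?B = "min \<mu> \<nu>"
  have "sum ?f {j..\<mu>} = (\<Sum>p=j..?B. (a * b) ^ (p - j) * a ^ (\<nu> - ?B) * b ^ (\<mu> - ?B) *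
            (if p < ?B then 1 - a else 1))"
  proof (cases "\<mu> \<le> \<nu>")
    case True
    then show ?thesis by (intro sum.cong) auto
  next
    case False
    then have "{j..\<mu>} = {j..<\<nu>} \<union> {\<nu>..\<mu>}" using assms by auto
    moreover have "sum ?f ({j..<\<nu>} \<union> {\<nu>..\<mu>}) = sum ?f {j..<\<nu>} + sum ?f {\<nu>..\<mu>}"
      by (rule sum.union_disjoint) auto
    ultimately have "sum ?f {j..\<mu>} = sum ?f {j..<\<nu>} + sum ?f {\<nu>..\<mu>}" by simp
    \<comment> \<open>The terms with \<open>p \<ge> \<nu>\<close> telescope into a single one, which
      becomes the new endpoint \<open>p = \<nu>\<close>.\<close>
    moreover have "sum ?f {\<nu>..\<mu>} = (a * b) ^ (\<nu> - j) * b ^ (\<mu> - \<nu>) *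
        (\<Sum>p=\<nu>..\<mu>. a ^ (p - \<nu>) * (if p < \<mu> then 1 - a else 1))"
      unfolding sum_distrib_left
    proof (intro sum.cong refl)
      fix p assume p: "p \<in> {\<nu>..\<mu>}"
      have "b ^ (\<mu> - \<nu>) = b ^ (p - \<nu>) * b ^ (\<mu> - p)"
        using p by (simp add: power_add[symmetric])
      moreover have "(a * b) ^ (p - j) = (a * b) ^ (\<nu> - j) * (a ^ (p - \<nu>) * b ^ (p - \<nu>))"
        using p assms by (simp add: power_add[symmetric] power_mult_distrib[symmetric])
      ultimately show "?f p = (a * b) ^ (\<nu> - j) * b ^ (\<mu> - \<nu>) *
          (a ^ (p - \<nu>) * (if p < \<mu> then 1 - a else 1))"
        using p False by (simp add: max_def mult_ac)
    qed
    moreover have "sum ?f {j..<\<nu>} = (\<Sum>p=j..<\<nu>. (a * b) ^ (p - j) * b ^ (\<mu> - \<nu>) * (1 - a))"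
      using False by (intro sum.cong) (auto simp: max_def)
    ultimately show ?thesis
      using telescope_up[of \<nu> \<mu> a] False assms
      by (simp add: atLeastLessThanSuc_atLeastAtMost[symmetric] min_def mult_ac)
  qed
  \<comment> \<open>Under \<open>q = j + ?B - p\<close> the distance \<open>p - j\<close> becomes
    \<open>?B - q\<close>, which completes the exponents to \<open>\<mu> - q\<close> and
    \<open>\<nu> - q\<close>.\<close>
  also have "\<dots> = sum ?g {j..?B}"
  proof (rule sum.reindex_bij_witness[where i = "\<lambda>q. j + ?B - q" and j = "\<lambda>q. j + ?B - q"])
    fix p assume p: "p \<in> {j..?B}"
    have "b ^ (\<mu> - (j + ?B - p)) = b ^ (p - j) * b ^ (\<mu> - ?B)"
      "a ^ (\<nu> - (j + ?B - p)) = a ^ (p - j) * a ^ (\<nu> - ?B)"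
      using p by (auto simp: power_add[symmetric] intro!: arg_cong[where f = "power _"])
    moreover have "j < j + ?B - p \<longleftrightarrow> p < ?B" by auto
    ultimately show "?g (j + ?B - p) = (a * b) ^ (p - j) * a ^ (\<nu> - ?B) * b ^ (\<mu> - ?B) *
            (if p < ?B then 1 - a else 1)"
      by (simp only: power_mult_distrib mult_ac)
  qed auto
  finally show ?thesis .
qed

text \<open>The exchange at one site \<open>s\<close>: \<open>p\<close> is part \<open>s + 1\<close>
  of the upper partition, \<open>q\<close> is part \<open>s\<close> of the lower one, and primes
  mark part \<open>s + 1\<close> of the two fixed partitions.\<close>

lemma site_identity:
  fixes a b :: "'r :: comm_ring_1"
  assumes "\<mu>' \<le> \<mu>" "\<nu>' \<le> \<nu>"
  shows "(\<Sum>p=max \<mu>' \<nu>'..\<mu>. (a * b) ^ (p - max \<mu>' \<nu>') * a ^ (max \<mu> \<nu> - \<mu>) *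
            b ^ (max \<mu> \<nu> - max \<nu> p) * (if p < \<mu> then 1 - a else 1)) =
         (\<Sum>q=\<nu>'..min \<mu> \<nu>. b ^ (\<mu> - max q \<mu>') * a ^ (\<nu> - q) * (if \<nu>' < q then 1 - a else 1))"
    (is "?L = sum ?g _")
proof -
  \<comment> \<open>In turn: both ranges are empty; \<open>site_identity_aux\<close> applies at
    \<open>\<nu>'\<close>; it applies at \<open>\<mu>'\<close> once the small \<open>q\<close> are
    collapsed; both sides telescope to \<open>b ^ (\<mu> - \<mu>')\<close>.\<close>
  consider "\<nu>' > \<mu>" | "\<nu>' \<le> \<mu>" "\<mu>' \<le> \<nu>'" | "\<nu>' < \<mu>'" "\<mu>' \<le> \<nu>" | "\<nu>' < \<mu>'" "\<nu> < \<mu>'"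
    using assms by linarith
  then show ?thesis
  proof cases
    case 1
    then show ?thesis by simp
  next
    case 2
    then have "?L = (\<Sum>q=\<nu>'..min \<mu> \<nu>. b ^ (\<mu> - q) * a ^ (\<nu> - q) * (if \<nu>' < q then 1 - a else 1))"
      using site_identity_aux[of \<nu>' \<mu> \<nu> a b] assms by (simp add: max_absorb2)
    also have "\<dots> = sum ?g {\<nu>'..min \<mu> \<nu>}"
      using 2 by (intro sum.cong) (auto simp: max_absorb1)
    finally show ?thesis .
  next
    case 3
    have split: "{\<nu>'..min \<mu> \<nu>} = {\<nu>'..\<mu>'} \<union> {\<mu>'<..min \<mu> \<nu>}" using 3 assms by auto
    have "sum ?g {\<nu>'..min \<mu> \<nu>} = sum ?g {\<nu>'..\<mu>'} + sum ?g {\<mu>'<..min \<mu> \<nu>}"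
      unfolding split by (rule sum.union_disjoint) auto
    \<comment> \<open>For \<open>q \<le> \<mu>'\<close> the power of \<open>b\<close> is constant,
      so these terms telescope to the endpoint term that the sum from \<open>\<mu>'\<close>
      requires.\<close>
    also have "sum ?g {\<nu>'..\<mu>'} = b ^ (\<mu> - \<mu>') * a ^ (\<nu> - \<mu>') *
        (\<Sum>q=\<nu>'..\<mu>'. a ^ (\<mu>' - q) * (if \<nu>' < q then 1 - a else 1))"
      unfolding sum_distrib_left
    proof (intro sum.cong refl)
      fix q assume q: "q \<in> {\<nu>'..\<mu>'}"
      have "a ^ (\<nu> - q) = a ^ (\<nu> - \<mu>') * a ^ (\<mu>' - q)"
        using q 3 by (simp add: power_add[symmetric])
      then show "?g q = b ^ (\<mu> - \<mu>') * a ^ (\<nu> - \<mu>') * (a ^ (\<mu>' - q) * (if \<nu>' < q then 1 - a else 1))"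
        using q by (simp add: max_absorb2 mult_ac)
    qed
    also have "(\<Sum>q=\<nu>'..\<mu>'. a ^ (\<mu>' - q) * (if \<nu>' < q then 1 - a else 1)) = 1"
      using 3 by (intro telescope_down) simp
    also have "sum ?g {\<mu>'<..min \<mu> \<nu>} =
        (\<Sum>q\<in>{\<mu>'<..min \<mu> \<nu>}. b ^ (\<mu> - q) * a ^ (\<nu> - q) * (if \<mu>' < q then 1 - a else 1))"
      using 3 by (intro sum.cong) (auto simp: max_absorb1)
    also have "b ^ (\<mu> - \<mu>') * a ^ (\<nu> - \<mu>') * 1 + \<dots> =
        (\<Sum>q=\<mu>'..min \<mu> \<nu>. b ^ (\<mu> - q) * a ^ (\<nu> - q) * (if \<mu>' < q then 1 - a else 1))"
      using 3 assms by (subst sum.head) auto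
    also have "\<dots> = ?L"
      using site_identity_aux[of \<mu>' \<mu> \<nu> a b] 3 assms by (simp add: max_absorb1)
    finally show ?thesis by simp
  next
    case 4
    have "?L = b ^ (\<mu> - \<mu>') * (\<Sum>p=\<mu>'..\<mu>. a ^ (p - \<mu>') * (if p < \<mu> then 1 - a else 1))"
      unfolding sum_distrib_left
    proof (intro sum.cong)
      show "{max \<mu>' \<nu>'..\<mu>} = {\<mu>'..\<mu>}" using 4 by auto
      fix p assume p: "p \<in> {\<mu>'..\<mu>}"
      have "b ^ (\<mu> - \<mu>') = b ^ (p - \<mu>') * b ^ (\<mu> - p)"
        using p by (simp add: power_add[symmetric])
      then show "(a * b) ^ (p - max \<mu>' \<nu>') * a ^ (max \<mu> \<nu> - \<mu>) *
            b ^ (max \<mu> \<nu> - max \<nu> p) * (if p < \<mu> then 1 - a else 1) =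
          b ^ (\<mu> - \<mu>') * (a ^ (p - \<mu>') * (if p < \<mu> then 1 - a else 1))"
        using p 4 by (simp add: max_def power_mult_distrib mult_ac)
    qed
    also have "\<dots> = b ^ (\<mu> - \<mu>') * (\<Sum>q=\<nu>'..\<nu>. a ^ (\<nu> - q) * (if \<nu>' < q then 1 - a else 1))"
      using assms telescope_up[of \<mu>' \<mu> a] telescope_down[of \<nu>' \<nu> a] by simp
    also have "\<dots> = sum ?g {\<nu>'..min \<mu> \<nu>}"
      unfolding sum_distrib_left using 4 assms by (intro sum.cong) (auto simp: max_def mult_ac)
    finally show ?thesis .
  qed
qed

text \<open>Distributivity over choice functions, extended by 0 instead of \<open>undefined\<close>
  so that they can be partitions.\<close>

lemma prod_sum_extend_zero:
  fixes f :: "'i \<Rightarrow> nat \<Rightarrow> 'r :: comm_ring_1"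
  assumes "finite S" "\<And>s. s \<in> S \<Longrightarrow> finite (B s)"
  shows "(\<Sum>g\<in>{g. (\<forall>s\<in>S. g s \<in> B s) \<and> (\<forall>s. s \<notin> S \<longrightarrow> g s = 0)}. \<Prod>s\<in>S. f s (g s)) =
         (\<Prod>s\<in>S. \<Sum>p\<in>B s. f s p)"
proof -
  have "(\<Sum>g\<in>{g. (\<forall>s\<in>S. g s \<in> B s) \<and> (\<forall>s. s \<notin> S \<longrightarrow> g s = 0)}. \<Prod>s\<in>S. f s (g s)) =
        (\<Sum>g\<in>PiE S B. \<Prod>s\<in>S. f s (g s))"
  proof (rule sum.reindex_bij_witness[where i = "\<lambda>g s. if s \<in> S then g s else 0"
          and j = "\<lambda>g. restrict g S"])
    fix g assume g: "g \<in> {g. (\<forall>s\<in>S. g s \<in> B s) \<and> (\<forall>s. s \<notin> S \<longrightarrow> g s = 0)}"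
    then show "(\<lambda>s. if s \<in> S then restrict g S s else 0) = g" by (intro ext) simp
    show "restrict g S \<in> PiE S B" using g by simp
    show "(\<Prod>s\<in>S. f s (restrict g S s)) = (\<Prod>s\<in>S. f s (g s))" by simp
  next
    fix g assume g: "g \<in> PiE S B"
    then show "restrict (\<lambda>s. if s \<in> S then g s else 0) S = g"
      by (intro ext) (simp add: PiE_arb[OF g] restrict_def)
    show "(\<lambda>s. if s \<in> S then g s else 0) \<in> {g. (\<forall>s\<in>S. g s \<in> B s) \<and> (\<forall>s. s \<notin> S \<longrightarrow> g s = 0)}"
      using g by (auto simp: PiE_mem)
  qed
  then show ?thesis using assms by (simp add: prod_sum_PiE)
qed

section \<open>Rows of the two models as products over the sites\<close>

abbreviation U_row :: "(nat \<Rightarrow> 'r :: comm_ring_1) \<Rightarrow> (nat \<Rightarrow> nat) \<Rightarrow> (nat \<Rightarrow> nat) \<Rightarrow> 'r" where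
  "U_row a \<equiv> row_weight (\<lambda>s. U_weight (a s))"

abbreviation dual_row :: "(nat \<Rightarrow> 'r :: comm_ring_1) \<Rightarrow> (nat \<Rightarrow> nat) \<Rightarrow> (nat \<Rightarrow> nat) \<Rightarrow> 'r" where
  "dual_row b \<equiv> row_weight (\<lambda>s. dual_weight (b s))"

text \<open>For labels that are differences of parts, \<open>b > c\<close> reads
  \<open>l' < \<mu>\<close>, and the vanishing case \<open>b < c\<close> is a violation of the
  horizontal strip condition.\<close>

lemma U_weight_row:
  assumes "\<mu>' \<le> \<mu>" "l' \<le> l" "\<mu> \<le> l" "\<mu>' \<le> l'"
  shows "U_weight a (l - \<mu>) (\<mu> - \<mu>') (l' - \<mu>') (l - l') =
    (if l' \<le> \<mu> then a ^ (l - \<mu>) * (if l' < \<mu> then 1 - a else 1) else 0)"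
  using assms by (auto simp: U_weight_def)

lemma dual_weight_row:
  assumes "\<mu>' \<le> \<mu>" "l' \<le> l" "\<mu> \<le> l" "\<mu>' \<le> l'"
  shows "dual_weight b (l - \<mu>) (\<mu> - \<mu>') (l' - \<mu>') (l - l') = b ^ (l - max \<mu> l')"
proof -
  have "min (l - \<mu>) (l - l') = l - max \<mu> l'" by (auto simp: max_def min_def)
  then show ?thesis using assms by (auto simp: dual_weight_def)
qed

lemma row_weight_U:
  assumes "\<mu> \<in> partitions" "l \<in> partitions" "\<mu> \<le> l" "\<And>s. s > L \<Longrightarrow> l s = 0"
    "\<And>s. s \<in> {1..L} \<Longrightarrow> l (s + 1) \<le> \<mu> s"
  shows "U_row a \<mu> l =
    (\<Prod>s=1..L. a s ^ (l s - \<mu> s) * (if l (s + 1) < \<mu> s then 1 - a s else 1))"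
proof -
  have "U_row a \<mu> l = (\<Prod>s=1..L. U_weight (a s) (l s - \<mu> s)
      (\<mu> s - \<mu> (s + 1)) (l (s + 1) - \<mu> (s + 1)) (l s - l (s + 1)))"
    using assms by (intro row_weight_eq_prod) (auto simp: U_weight_def)
  also have "\<dots> = (\<Prod>s=1..L. a s ^ (l s - \<mu> s) * (if l (s + 1) < \<mu> s then 1 - a s else 1))"
    using assms(3,5) partitions_step[OF assms(1)] partitions_step[OF assms(2)]
    by (intro prod.cong refl, subst U_weight_row) (auto simp: le_fun_def)
  finally show ?thesis .
qed

lemma row_weight_U_eq_0:
  assumes "\<mu> \<in> partitions" "l \<in> partitions" "s \<ge> 1" "l (s + 1) > \<mu> s"
  shows "U_row a \<mu> l = 0"
proof (cases "\<mu> \<le> l")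
  case True
  obtain L where L: "\<And>s. s \<ge> L \<Longrightarrow> l s = 0" using partitions_eventually_zero[OF assms(2)] by metis
  have "U_row a \<mu> l = (\<Prod>s=1..L. U_weight (a s) (l s - \<mu> s)
      (\<mu> s - \<mu> (s + 1)) (l (s + 1) - \<mu> (s + 1)) (l s - l (s + 1)))"
    using True L by (intro row_weight_eq_prod) (auto simp: U_weight_def)
  also have "\<dots> = 0"
  proof (rule prod_zero)
    have "s \<le> L" using assms(4) L[of "s + 1"] by (cases "s \<le> L") auto
    moreover have "U_weight (a s) (l s - \<mu> s) (\<mu> s - \<mu> (s + 1)) (l (s + 1) - \<mu> (s + 1)) (l s - l (s + 1)) = 0"
      using assms True partitions_step[OF assms(1)] partitions_step[OF assms(2)]
      by (subst U_weight_row) (auto simp: le_fun_def)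
    ultimately show "\<exists>s\<in>{1..L}. U_weight (a s) (l s - \<mu> s)
      (\<mu> s - \<mu> (s + 1)) (l (s + 1) - \<mu> (s + 1)) (l s - l (s + 1)) = 0"
      using assms(3) by auto
  qed simp
  finally show ?thesis .
qed (simp add: row_weight_def)

lemma row_weight_dual:
  assumes "\<mu> \<in> partitions" "l \<in> partitions" "\<mu> \<le> l" "\<And>s. s > L \<Longrightarrow> l s = 0"
  shows "dual_row b \<mu> l = (\<Prod>s=1..L. b s ^ (l s - max (\<mu> s) (l (s + 1))))"
proof -
  have "dual_row b \<mu> l = (\<Prod>s=1..L. dual_weight (b s) (l s - \<mu> s)
      (\<mu> s - \<mu> (s + 1)) (l (s + 1) - \<mu> (s + 1)) (l s - l (s + 1)))"
    using assms by (intro row_weight_eq_prod) (auto simp: dual_weight_def)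
  also have "\<dots> = (\<Prod>s=1..L. b s ^ (l s - max (\<mu> s) (l (s + 1))))"
    using assms(3) partitions_step[OF assms(1)] partitions_step[OF assms(2)]
    by (intro prod.cong refl, subst dual_weight_row) (auto simp: le_fun_def)
  finally show ?thesis .
qed

text \<open>Each factor of either row contains a single part of \<kappa>, and in the nonzero terms
  these parts vary independently, so the sum is a product over the sites.\<close>

lemma dual_skew_sum:
  fixes a b :: "nat \<Rightarrow> 'r :: comm_ring_1"
  assumes \<mu>: "\<mu> \<in> partitions" "\<And>s. s > L \<Longrightarrow> \<mu> s = 0"
    and \<nu>: "\<nu> \<in> partitions" "\<And>s. s > L \<Longrightarrow> \<nu> s = 0"
  shows "(\<Sum>\<kappa>\<in>{\<kappa> \<in> partitions. \<kappa> \<le> \<mu>}.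
            dual_row b \<kappa> \<mu> * U_row a \<kappa> \<nu>) =
         (\<Prod>s=1..L. \<Sum>q=\<nu> (s + 1)..min (\<mu> s) (\<nu> s).
            b s ^ (\<mu> s - max q (\<mu> (s + 1))) * a s ^ (\<nu> s - q) * (if \<nu> (s + 1) < q then 1 - a s else 1))"
proof -
  \<comment> \<open>The horizontal strip condition for \<open>U_row a \<kappa> \<nu>\<close> gives
    the lower bounds; \<open>\<kappa> \<le> \<mu>\<close> and \<open>\<kappa> \<le> \<nu>\<close>
    give the upper ones.\<close>
  define A where "A = {\<kappa>. (\<forall>s\<in>{1..L}. \<kappa> s \<in> {\<nu> (s + 1)..min (\<mu> s) (\<nu> s)}) \<and> (\<forall>s. s \<notin> {1..L} \<longrightarrow> \<kappa> s = 0)}"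
  have A: "\<kappa> \<in> partitions" "\<kappa> \<le> \<mu>" "\<kappa> \<le> \<nu>" "\<And>s. s \<ge> 1 \<Longrightarrow> \<nu> (s + 1) \<le> \<kappa> s" if "\<kappa> \<in> A" for \<kappa>
  proof -
    show le: "\<kappa> \<le> \<mu>" "\<kappa> \<le> \<nu>"
      unfolding le_fun_def
    proof -
      have "\<kappa> s \<le> \<mu> s \<and> \<kappa> s \<le> \<nu> s" for s
        using that by (cases "s \<in> {1..L}") (auto simp: A_def)
      then show "\<forall>s. \<kappa> s \<le> \<mu> s" "\<forall>s. \<kappa> s \<le> \<nu> s" by auto
    qed
    show lo: "\<nu> (s + 1) \<le> \<kappa> s" if "s \<ge> 1" for s
      using \<open>\<kappa> \<in> A\<close> that \<nu>(2)[of "s + 1"] by (cases "s \<le> L") (auto simp: A_def)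
    have "{s. \<kappa> s \<noteq> 0} \<subseteq> {1..L}" using that by (auto simp: A_def)
    then have "finite {s. \<kappa> s \<noteq> 0}" by (rule finite_subset) simp
    \<comment> \<open>Monotonicity is automatic:
      \<open>\<kappa> (s + 1) \<le> \<nu> (s + 1) \<le> \<kappa> s\<close>.\<close>
    moreover have "\<kappa> (s + 1) \<le> \<kappa> s" if "s \<ge> 1" for s
      using lo[OF that] le(2) by (meson le_fun_def order.trans)
    moreover have "\<kappa> 0 = 0" using that by (auto simp: A_def)
    ultimately show "\<kappa> \<in> partitions" by (simp add: partitions_def)
  qed
  have "(\<Sum>\<kappa>\<in>{\<kappa> \<in> partitions. \<kappa> \<le> \<mu>}.
      dual_row b \<kappa> \<mu> * U_row a \<kappa> \<nu>) =
    (\<Sum>\<kappa>\<in>A. dual_row b \<kappa> \<mu> * U_row a \<kappa> \<nu>)"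
  proof (rule sum.mono_neutral_right)
    show "finite {\<kappa> \<in> partitions. \<kappa> \<le> \<mu>}" using \<mu>(1) by (rule finite_partitions_below)
    show "A \<subseteq> {\<kappa> \<in> partitions. \<kappa> \<le> \<mu>}" using A by auto
    show "\<forall>\<kappa>\<in>{\<kappa> \<in> partitions. \<kappa> \<le> \<mu>} - A.
      dual_row b \<kappa> \<mu> * U_row a \<kappa> \<nu> = 0"
    proof clarify
      fix \<kappa> assume \<kappa>: "\<kappa> \<in> partitions" "\<kappa> \<le> \<mu>" "\<kappa> \<notin> A"
      have z: "\<kappa> s = 0" if "s \<notin> {1..L}" for s
        using that partitions_0[OF \<kappa>(1)] \<mu>(2)[of s] \<kappa>(2) by (cases "s = 0") (auto simp: le_fun_def dest: spec[of _ s])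
      have "U_row a \<kappa> \<nu> = 0"
      proof (cases "\<kappa> \<le> \<nu>")
        case True
        then obtain s where s: "s \<in> {1..L}" "\<nu> (s + 1) > \<kappa> s"
          using \<kappa> z by (force simp: A_def le_fun_def)
        then show ?thesis using \<kappa>(1) \<nu>(1) by (intro row_weight_U_eq_0[of _ _ s]) auto
      qed (simp add: row_weight_def)
      then show "dual_row b \<kappa> \<mu> * U_row a \<kappa> \<nu> = 0"
        by simp
    qed
  qed
  also have "\<dots> = (\<Sum>\<kappa>\<in>A. \<Prod>s=1..L. b s ^ (\<mu> s - max (\<kappa> s) (\<mu> (s + 1))) * a s ^ (\<nu> s - \<kappa> s) *
      (if \<nu> (s + 1) < \<kappa> s then 1 - a s else 1))"
  proof (rule sum.cong[OF refl])
    fix \<kappa> assume "\<kappa> \<in> A"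
    note \<kappa> = A[OF this]
    have "dual_row b \<kappa> \<mu> = (\<Prod>s=1..L. b s ^ (\<mu> s - max (\<kappa> s) (\<mu> (s + 1))))"
      using \<kappa> \<mu> by (intro row_weight_dual) auto
    moreover have "U_row a \<kappa> \<nu> =
      (\<Prod>s=1..L. a s ^ (\<nu> s - \<kappa> s) * (if \<nu> (s + 1) < \<kappa> s then 1 - a s else 1))"
      using \<kappa> \<nu> by (intro row_weight_U) auto
    ultimately show "dual_row b \<kappa> \<mu> * U_row a \<kappa> \<nu> =
      (\<Prod>s=1..L. b s ^ (\<mu> s - max (\<kappa> s) (\<mu> (s + 1))) * a s ^ (\<nu> s - \<kappa> s) *
        (if \<nu> (s + 1) < \<kappa> s then 1 - a s else 1))"
      by (simp add: prod.distrib mult.assoc)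
  qed
  also have "\<dots> = (\<Prod>s=1..L. \<Sum>q=\<nu> (s + 1)..min (\<mu> s) (\<nu> s).
      b s ^ (\<mu> s - max q (\<mu> (s + 1))) * a s ^ (\<nu> s - q) * (if \<nu> (s + 1) < q then 1 - a s else 1))"
    unfolding A_def by (rule prod_sum_extend_zero) auto
  finally show ?thesis .
qed

lemma prod_split_first:
  fixes F :: "nat \<Rightarrow> 'r :: comm_monoid_mult"
  shows "(\<Prod>s=1..Suc L. F s) = F 1 * (\<Prod>s=1..L. F (Suc s))"
  by (induction L) (simp_all add: mult.assoc)

text \<open>Cutting off the first part of \<open>l\<close> truncates the geometric series, so the
  exchange becomes an identity of finite sums, valid in every commutative ring.\<close>

lemma skew_Cauchy_truncated:
  fixes a b :: "nat \<Rightarrow> 'r :: comm_ring_1" and K :: nat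
  assumes \<mu>: "\<mu> \<in> partitions" and \<nu>: "\<nu> \<in> partitions" and t: "\<And>s. s \<ge> 1 \<Longrightarrow> a s * b s = t"
  defines "\<Lambda> \<equiv> {l \<in> partitions. \<mu> \<le> l \<and> \<nu> \<le> l \<and> (\<forall>s\<ge>1. l (s + 1) \<le> \<mu> s) \<and> l 1 \<le> max (\<mu> 1) (\<nu> 1) + K}"
  shows "(\<Sum>l\<in>\<Lambda>. U_row a \<mu> l * dual_row b \<nu> l) =
    (\<Sum>k\<le>K. t ^ k) * (\<Sum>\<kappa>\<in>{\<kappa> \<in> partitions. \<kappa> \<le> \<mu>}.
       dual_row b \<kappa> \<mu> * U_row a \<kappa> \<nu>)"
proof -
  obtain L1 where L1: "\<And>s. s \<ge> L1 \<Longrightarrow> \<mu> s = 0" using partitions_eventually_zero[OF \<mu>] by metis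
  obtain L2 where L2: "\<And>s. s \<ge> L2 \<Longrightarrow> \<nu> s = 0" using partitions_eventually_zero[OF \<nu>] by metis
  define L where "L = max L1 L2"
  have L: "\<mu> s = 0" "\<nu> s = 0" if "s > L" for s using that L1 L2 by (auto simp: L_def)
  define M where "M s = max (\<mu> s) (\<nu> s)" for s
  \<comment> \<open>Only the first part has no natural upper bound; later parts are bounded by the
    previous part of \<mu>.\<close>
  define B where "B s = (if s = 1 then {M 1..M 1 + K} else {M s..\<mu> (s - 1)})" for s
  \<comment> \<open>\<open>f s\<close> gathers what depends on part \<open>s\<close>: the power of
    \<open>t\<close> from site \<open>s\<close> and the rest of the weight from site
    \<open>s - 1\<close>.\<close>
  define f where "f s p = (if s = 1 then t ^ (p - M 1) else
      t ^ (p - M s) * a (s - 1) ^ (M (s - 1) - \<mu> (s - 1)) * b (s - 1) ^ (M (s - 1) - max (\<nu> (s - 1)) p) *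
      (if p < \<mu> (s - 1) then 1 - a (s - 1) else 1))" for s p
  \<comment> \<open>Site \<open>Suc L\<close> occurs because a horizontal strip may add one part.
    The intervals force a partition:
    \<open>l (s + 1) \<le> \<mu> s \<le> M s \<le> l s\<close>.\<close>
  have \<Lambda>: "\<Lambda> = {l. (\<forall>s\<in>{1..Suc L}. l s \<in> B s) \<and> (\<forall>s. s \<notin> {1..Suc L} \<longrightarrow> l s = 0)}" (is "_ = ?R")
  proof (intro equalityI subsetI)
    fix l assume l: "l \<in> \<Lambda>"
    have "l s \<in> B s" if "s \<in> {1..Suc L}" for s
      using l that by (cases s) (auto simp: \<Lambda>_def B_def M_def le_fun_def)
    moreover have "l s = 0" if "s \<notin> {1..Suc L}" for s
    proof (cases "s = 0")
      case False
      then have "l s \<le> \<mu> (s - 1)" "\<mu> (s - 1) = 0"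
        using l that L[of "s - 1"] by (auto simp: \<Lambda>_def dest: spec[of _ "s - 1"])
      then show ?thesis by simp
    qed (use l partitions_0 in \<open>auto simp: \<Lambda>_def\<close>)
    ultimately show "l \<in> ?R" by blast
  next
    fix l assume l: "l \<in> ?R"
    have M: "M s \<le> l s" for s
    proof (cases "s \<in> {1..Suc L}")
      case True
      then have "l s \<in> B s" using l by blast
      then show ?thesis by (auto simp: B_def split: if_splits)
    qed (use L[of s] partitions_0[OF \<mu>] partitions_0[OF \<nu>] in \<open>cases "s = 0"; auto simp: M_def\<close>)
    have up: "l (s + 1) \<le> \<mu> s" if "s \<ge> 1" for s
    proof (cases "s \<le> L")
      case True
      then have "l (s + 1) \<in> B (s + 1)" using l by auto
      then show ?thesis using that by (simp add: B_def)
    qed (use l in auto)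
    have "{s. l s \<noteq> 0} \<subseteq> {1..Suc L}" using l by auto
    then have "finite {s. l s \<noteq> 0}" by (rule finite_subset) simp
    moreover have "l (s + 1) \<le> l s" if "s \<ge> 1" for s
      using up[OF that] M[of s] by (simp add: M_def)
    moreover have "l 0 = 0" using l by auto
    ultimately have "l \<in> partitions" by (simp add: partitions_def)
    moreover have "l 1 \<in> B 1" using l by auto
    ultimately show "l \<in> \<Lambda>"
      using M up by (auto simp: \<Lambda>_def le_fun_def M_def B_def)
  qed
  have "(\<Sum>l\<in>\<Lambda>. U_row a \<mu> l * dual_row b \<nu> l) =
    (\<Sum>l\<in>\<Lambda>. \<Prod>s=1..Suc L. f s (l s))"
  proof (rule sum.cong[OF refl])
    fix l assume l: "l \<in> \<Lambda>"
    then have l': "l \<in> partitions" "\<mu> \<le> l" "\<nu> \<le> l" "\<And>s. s \<ge> 1 \<Longrightarrow> l (s + 1) \<le> \<mu> s"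
      by (auto simp: \<Lambda>_def)
    have z: "l s = 0" if "s > Suc L" for s using l that unfolding \<Lambda> by auto
    have M: "M s \<le> l s" for s using l' by (simp add: M_def le_fun_def)
    \<comment> \<open>Splitting \<open>t ^ (l s - M s)\<close> off the weights at site
      \<open>s\<close> leaves \<open>e s\<close>, which depends on \<open>l\<close> only through
      part \<open>s + 1\<close>.\<close>
    define e where "e s = a s ^ (M s - \<mu> s) * b s ^ (M s - max (\<nu> s) (l (s + 1))) *
      (if l (s + 1) < \<mu> s then 1 - a s else 1)" for s
    have "U_row a \<mu> l * dual_row b \<nu> l =
      (\<Prod>s=1..Suc L. a s ^ (l s - \<mu> s) * (if l (s + 1) < \<mu> s then 1 - a s else 1)) *
      (\<Prod>s=1..Suc L. b s ^ (l s - max (\<nu> s) (l (s + 1))))"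
      using l' \<mu> \<nu> z row_weight_U[of \<mu> l "Suc L" a] row_weight_dual[of \<nu> l "Suc L" b] by simp
    also have "\<dots> = (\<Prod>s=1..Suc L. t ^ (l s - M s) * e s)"
      unfolding prod.distrib[symmetric]
    proof (rule prod.cong[OF refl])
      fix s assume "s \<in> {1..Suc L}"
      then have s: "s \<ge> 1" by simp
      have "max (\<nu> s) (l (s + 1)) \<le> M s" using l'(4)[OF s] by (auto simp: M_def)
      then have "b s ^ (l s - max (\<nu> s) (l (s + 1))) = b s ^ (l s - M s) * b s ^ (M s - max (\<nu> s) (l (s + 1)))"
        using M[of s] by (simp add: power_add[symmetric])
      moreover have "a s ^ (l s - \<mu> s) = a s ^ (l s - M s) * a s ^ (M s - \<mu> s)"
        using M[of s] by (simp add: power_add[symmetric] M_def)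
      ultimately show "a s ^ (l s - \<mu> s) * (if l (s + 1) < \<mu> s then 1 - a s else 1) *
          b s ^ (l s - max (\<nu> s) (l (s + 1))) = t ^ (l s - M s) * e s"
        unfolding t[OF s, symmetric] e_def by (simp only: power_mult_distrib mult_ac)
    qed
    \<comment> \<open>\<open>e (Suc L) = 1\<close>, since \<mu>, \<nu> and the next part of
      \<open>l\<close> vanish there. This shift pairs \<open>e s\<close> with the power of
      \<open>t\<close> at site \<open>s + 1\<close>.\<close>
    also have "\<dots> = (\<Prod>s=1..Suc L. t ^ (l s - M s)) * (\<Prod>s=1..L. e s)"
      using L[of "Suc L"] z[of "Suc (Suc L)"] by (simp add: prod.distrib e_def M_def)
    also have "(\<Prod>s=1..Suc L. t ^ (l s - M s)) = t ^ (l 1 - M 1) * (\<Prod>s=1..L. t ^ (l (Suc s) - M (Suc s)))"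
      by (rule prod_split_first)
    also have "\<dots> * (\<Prod>s=1..L. e s) = t ^ (l 1 - M 1) * (\<Prod>s=1..L. f (Suc s) (l (Suc s)))"
      unfolding mult.assoc prod.distrib[symmetric]
      by (intro arg_cong2[where f = "(*)"] prod.cong refl) (auto simp: f_def e_def mult_ac)
    also have "\<dots> = (\<Prod>s=1..Suc L. f s (l s))"
      by (simp only: prod_split_first[of "\<lambda>s. f s (l s)"]) (simp add: f_def)
    finally show "U_row a \<mu> l * dual_row b \<nu> l =
      (\<Prod>s=1..Suc L. f s (l s))" .
  qed
  also have "\<dots> = (\<Prod>s=1..Suc L. \<Sum>p\<in>B s. f s p)"
    unfolding \<Lambda> by (rule prod_sum_extend_zero) (auto simp: B_def)
  also have "\<dots> = (\<Sum>p\<in>B 1. f 1 p) * (\<Prod>s=1..L. \<Sum>p\<in>B (Suc s). f (Suc s) p)"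
    by (rule prod_split_first)
  also have "(\<Sum>p\<in>B 1. f 1 p) = (\<Sum>k\<le>K. t ^ k)"
    by (rule sum.reindex_bij_witness[where i = "\<lambda>k. k + M 1" and j = "\<lambda>p. p - M 1"])
       (auto simp: B_def f_def)
  also have "(\<Prod>s=1..L. \<Sum>p\<in>B (Suc s). f (Suc s) p) =
    (\<Prod>s=1..L. \<Sum>q=\<nu> (s + 1)..min (\<mu> s) (\<nu> s).
      b s ^ (\<mu> s - max q (\<mu> (s + 1))) * a s ^ (\<nu> s - q) * (if \<nu> (s + 1) < q then 1 - a s else 1))"
  proof (rule prod.cong[OF refl])
    fix s assume "s \<in> {1..L}"
    then have s: "s \<ge> 1" by simp
    show "(\<Sum>p\<in>B (Suc s). f (Suc s) p) = (\<Sum>q=\<nu> (s + 1)..min (\<mu> s) (\<nu> s).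
      b s ^ (\<mu> s - max q (\<mu> (s + 1))) * a s ^ (\<nu> s - q) * (if \<nu> (s + 1) < q then 1 - a s else 1))"
      \<comment> \<open>The sum over part \<open>s + 1\<close> of \<open>l\<close> is traded for the
        sum over part \<open>s\<close> of \<kappa>.\<close>
      using site_identity[OF partitions_step[OF \<mu> s] partitions_step[OF \<nu> s], of "a s" "b s"] s
      by (simp add: B_def f_def M_def t[OF s] cong: if_cong)
  qed
  also have "\<dots> = (\<Sum>\<kappa>\<in>{\<kappa> \<in> partitions. \<kappa> \<le> \<mu>}.
       dual_row b \<kappa> \<mu> * U_row a \<kappa> \<nu>)"
    using L by (intro dual_skew_sum[symmetric] \<mu> \<nu>) auto
  finally show ?thesis .
qed

section \<open>Passage from finite sums to formal sums\<close>

lemma U_row_nonzero: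
  assumes "\<mu> \<in> partitions" "l \<in> partitions" "U_row a \<mu> l \<noteq> 0"
  shows "\<mu> \<le> l" "\<And>s. s \<ge> 1 \<Longrightarrow> l (s + 1) \<le> \<mu> s"
  using assms row_weight_U_eq_0[OF assms(1,2)] row_weight_eq_0 not_le by blast+

text \<open>The factor \<open>a 1 ^ (l 1 - \<mu> 1)\<close> at the first site already supplies the
  degree. This bound on \<open>l 1\<close> is the source of all finiteness below.\<close>

lemma mdeg_ge_U_row:
  assumes \<mu>: "\<mu> \<in> partitions" and l: "l \<in> partitions" and a: "mdeg_ge (a 1) 1"
  shows "mdeg_ge (U_row a \<mu> l) (l 1 - \<mu> 1)"
proof (cases "\<mu> \<le> l \<and> (\<forall>s\<ge>1. l (s + 1) \<le> \<mu> s)")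
  case True
  obtain L where L: "L \<ge> 1" "\<And>s. s \<ge> L \<Longrightarrow> l s = 0" using partitions_eventually_zero[OF l] by metis
  have "U_row a \<mu> l = (\<Prod>s=1..L. a s ^ (l s - \<mu> s) * (if l (s + 1) < \<mu> s then 1 - a s else 1))"
    using True L by (intro row_weight_U \<mu> l) auto
  also have "\<dots> = a 1 ^ (l 1 - \<mu> 1) * (if l (1 + 1) < \<mu> 1 then 1 - a 1 else 1) *
      (\<Prod>s\<in>{1..L} - {1}. a s ^ (l s - \<mu> s) * (if l (s + 1) < \<mu> s then 1 - a s else 1))"
    using L(1) by (intro prod.remove) auto
  finally show ?thesis
    using mdeg_ge_power[OF a] by (simp only: mdeg_ge_mult_left)
next
  case False
  then have "U_row a \<mu> l = 0"
    using U_row_nonzero[OF \<mu> l] by blast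
  then show ?thesis by simp
qed

text \<open>Modulo order \<open>d\<close> the sum is the truncated identity: discarded terms vanish
  or have a first part that forces order at least \<open>d\<close>, and the geometric tail has such
  an order too.\<close>

lemma skew_Cauchy:
  fixes a b :: "nat \<Rightarrow> ('v, 'a :: comm_ring_1) mfps"
  assumes \<mu>: "\<mu> \<in> partitions" and \<nu>: "\<nu> \<in> partitions"
    and t: "\<And>s. s \<ge> 1 \<Longrightarrow> a s * b s = t" and a: "mdeg_ge (a 1) 1"
  shows "has_formal_sum (\<lambda>l. U_row a \<mu> l * dual_row b \<nu> l) partitions
    (1 / (1 - t) * (\<Sum>\<kappa>\<in>{\<kappa> \<in> partitions. \<kappa> \<le> \<mu>}. dual_row b \<kappa> \<mu> * U_row a \<kappa> \<nu>))"
proof (rule has_formal_sum_degree)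
  fix d
  define \<Lambda> where "\<Lambda> = {l \<in> partitions. \<mu> \<le> l \<and> \<nu> \<le> l \<and> (\<forall>s\<ge>1. l (s + 1) \<le> \<mu> s) \<and>
    l 1 \<le> max (\<mu> 1) (\<nu> 1) + d}"
  define C where "C = (\<Sum>\<kappa>\<in>{\<kappa> \<in> partitions. \<kappa> \<le> \<mu>}. dual_row b \<kappa> \<mu> * U_row a \<kappa> \<nu>)"
  obtain L where L: "L \<ge> 1" "\<And>s. s \<ge> L \<Longrightarrow> \<mu> s = 0" using partitions_eventually_zero[OF \<mu>] by metis
  \<comment> \<open>The strip condition bounds the length of \<open>l\<close> by that of \<mu> plus
    one, so \<Lambda> lies in a finite box.\<close>
  have "l s = 0" if "l \<in> \<Lambda>" "s > L" for l s
  proof -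
    have "\<forall>s\<ge>1. l (s + 1) \<le> \<mu> s" using that by (simp add: \<Lambda>_def)
    moreover have "1 \<le> s - 1" using that(2) L(1) by simp
    ultimately have "l (s - 1 + 1) \<le> \<mu> (s - 1)" by blast
    then show ?thesis using that L by simp
  qed
  then have "\<Lambda> \<subseteq> {l \<in> partitions. l 1 \<le> max (\<mu> 1) (\<nu> 1) + d \<and> (\<forall>s>L. l s = 0)}"
    by (auto simp: \<Lambda>_def)
  then have "finite \<Lambda>" using finite_partitions_box finite_subset by blast
  moreover have "mdeg_ge (U_row a \<mu> l * dual_row b \<nu> l) d" if l: "l \<in> partitions - \<Lambda>" for l
  proof (cases "\<mu> \<le> l \<and> \<nu> \<le> l \<and> (\<forall>s\<ge>1. l (s + 1) \<le> \<mu> s)")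
    case True
    then have "d \<le> l 1 - \<mu> 1" using l by (auto simp: \<Lambda>_def)
    moreover have "mdeg_ge (U_row a \<mu> l) (l 1 - \<mu> 1)"
      using l by (intro mdeg_ge_U_row \<mu> a) simp
    ultimately show ?thesis by (blast intro: mdeg_ge_mult_left mdeg_ge_mono)
  next
    case False
    then have "U_row a \<mu> l = 0 \<or> dual_row b \<nu> l = 0"
      using l U_row_nonzero[OF \<mu>, of l a] row_weight_eq_0[of \<nu> l] by blast
    then show ?thesis by auto
  qed
  moreover have "mdeg_ge (1 / (1 - t) * C - (\<Sum>l\<in>\<Lambda>. U_row a \<mu> l * dual_row b \<nu> l)) d"
  proof -
    have "mdeg_ge t 1" using mdeg_ge_mult_left[OF a, of "b 1"] t[of 1] by simp
    then have "mdeg_ge (1 / (1 - t) - (\<Sum>k\<le>d. t ^ k)) d"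
      by (rule mdeg_ge_mono[OF geometric_series_mfps]) simp
    moreover have "(\<Sum>l\<in>\<Lambda>. U_row a \<mu> l * dual_row b \<nu> l) = (\<Sum>k\<le>d. t ^ k) * C"
      unfolding \<Lambda>_def C_def by (rule skew_Cauchy_truncated[OF \<mu> \<nu> t])
    ultimately show ?thesis
      using mdeg_ge_mult_left[of "1 / (1 - t) - (\<Sum>k\<le>d. t ^ k)" d C]
      by (simp add: left_diff_distrib)
  qed
  ultimately show "\<exists>K. finite K \<and> K \<subseteq> partitions \<and>
      (\<forall>l\<in>partitions - K. mdeg_ge (U_row a \<mu> l * dual_row b \<nu> l) d) \<and>
      mdeg_ge (1 / (1 - t) * (\<Sum>\<kappa>\<in>{\<kappa> \<in> partitions. \<kappa> \<le> \<mu>}. dual_row b \<kappa> \<mu> * U_row a \<kappa> \<nu>) -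
        (\<Sum>l\<in>K. U_row a \<mu> l * dual_row b \<nu> l)) d"
    unfolding C_def by (intro exI[of _ \<Lambda>]) (auto simp: \<Lambda>_def)
qed

section \<open>The Cauchy identity\<close>

lemma has_formal_sum_partition_function_Suc:
  assumes "l \<in> partitions"
  shows "has_formal_sum (\<lambda>\<mu>. partition_function N W \<mu> * row_weight (W (Suc N)) \<mu> l) partitions
    (partition_function (Suc N) W l)"
  unfolding partition_function_Suc[OF assms]
  using finite_partitions_below[OF assms]
  by (intro has_formal_sum_finite_support) (auto simp: row_weight_eq_0)

text \<open>One \<open>U\<close> row is pushed through all \<open>n\<close> dual rows by induction
  on \<open>n\<close>. The partition \<mu> is generalised because each exchange replaces it by
  smaller partitions \<kappa>.\<close>

lemma U_row_dual_sum:
  fixes a :: "nat \<Rightarrow> ('v, 'a :: comm_ring_1) mfps"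
  assumes t: "\<And>j s. s \<ge> 1 \<Longrightarrow> a s * b j s = t j" and a: "mdeg_ge (a 1) 1"
    and \<mu>: "\<mu> \<in> partitions"
  shows "has_formal_sum (\<lambda>l. U_row a \<mu> l * partition_function n (\<lambda>j s. dual_weight (b j s)) l) partitions
    ((\<Prod>j=1..n. 1 / (1 - t j)) * partition_function n (\<lambda>j s. dual_weight (b j s)) \<mu>)"
  using \<mu>
proof (induction n arbitrary: \<mu>)
  case 0
  have "has_formal_sum (\<lambda>l. U_row a \<mu> l * partition_function 0 (\<lambda>j s. dual_weight (b j s)) l) partitions
    (\<Sum>l\<in>{\<lambda>_. 0}. U_row a \<mu> l * partition_function 0 (\<lambda>j s. dual_weight (b j s)) l)"
    by (intro has_formal_sum_finite_support) (auto simp: partition_function_0)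
  moreover have "U_row a \<mu> (\<lambda>_. 0) = (if \<mu> = (\<lambda>_. 0) then 1 else 0)"
    by (simp add: row_weight_def partition_le_zero U_weight_def)
  ultimately show ?case using 0 by (simp add: partition_function_0)
next
  case (Suc n)
  let ?g = "\<lambda>n. partition_function n (\<lambda>j s. dual_weight (b j s))"
  let ?P = "{\<kappa> \<in> partitions. \<kappa> \<le> \<mu>}"
  let ?c = "1 / (1 - t (Suc n))"
  \<comment> \<open>Expanding the top dual row gives a double sum over \<open>l\<close> and \<nu>.
    Summing over \<open>l\<close> first is \<open>skew_Cauchy\<close>; the sum over \<nu> is then
    left to the induction hypothesis.\<close>
  show ?case
  proof (rule has_formal_sum_swap[where J = partitions
        and F = "\<lambda>l \<nu>. U_row a \<mu> l * (?g n \<nu> * dual_row (b (Suc n)) \<nu> l)"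
        and R = "\<lambda>\<nu>. ?g n \<nu> * (?c * (\<Sum>\<kappa>\<in>?P. dual_row (b (Suc n)) \<kappa> \<mu> * U_row a \<kappa> \<nu>))"])
    fix M :: "'v multiset"
    obtain L where L: "L \<ge> 1" "\<And>s. s \<ge> L \<Longrightarrow> \<mu> s = 0"
      using partitions_eventually_zero[OF Suc.prems] by metis
    \<comment> \<open>The degree bounds \<open>l 1\<close>, the strip condition bounds the length of
      \<open>l\<close> by \<mu>, and \<open>\<nu> \<le> l\<close> confines \<nu> as well.\<close>
    define Box where "Box = {l \<in> partitions. l 1 \<le> \<mu> 1 + size M \<and> (\<forall>s>L. l s = 0)}"
    have "l \<in> Box \<and> \<nu> \<in> Box" if l: "l \<in> partitions" "\<nu> \<in> partitions"
      and nz: "mcoeff (U_row a \<mu> l * (?g n \<nu> * dual_row (b (Suc n)) \<nu> l)) M \<noteq> 0" for l \<nu>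
    proof -
      have "U_row a \<mu> l \<noteq> 0" using nz by auto
      note U = U_row_nonzero[OF Suc.prems l(1) this]
      have "dual_row (b (Suc n)) \<nu> l \<noteq> 0" using nz by auto
      then have le: "\<nu> \<le> l" using row_weight_eq_0 by blast
      have "mdeg_ge (U_row a \<mu> l * (?g n \<nu> * dual_row (b (Suc n)) \<nu> l)) (l 1 - \<mu> 1)"
        by (intro mdeg_ge_mult_left mdeg_ge_U_row Suc.prems l a)
      then have "l 1 \<le> \<mu> 1 + size M" using nz by (force simp: mdeg_ge_def)
      moreover have z: "l s = 0" if "s > L" for s
        using U(2)[of "s - 1"] L that by simp
      moreover from le have le': "\<nu> s \<le> l s" for s by (simp add: le_fun_def)
      moreover have "\<nu> s = 0" if "s > L" for s using le'[of s] z[OF that] by simp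
      ultimately show ?thesis
        using l order.trans[OF le'[of 1]] by (simp add: Box_def)
    qed
    then have "{(l, \<nu>). l \<in> partitions \<and> \<nu> \<in> partitions \<and>
        mcoeff (U_row a \<mu> l * (?g n \<nu> * dual_row (b (Suc n)) \<nu> l)) M \<noteq> 0} \<subseteq> Box \<times> Box" by auto
    moreover have "finite (Box \<times> Box)" unfolding Box_def by (simp only: finite_cartesian_product finite_partitions_box)
    ultimately show "finite {(l, \<nu>). l \<in> partitions \<and> \<nu> \<in> partitions \<and>
        mcoeff (U_row a \<mu> l * (?g n \<nu> * dual_row (b (Suc n)) \<nu> l)) M \<noteq> 0}"
      by (rule finite_subset)
  next
    fix l assume "l \<in> partitions"
    then show "has_formal_sum (\<lambda>\<nu>. U_row a \<mu> l * (?g n \<nu> * dual_row (b (Suc n)) \<nu> l)) partitions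
        (U_row a \<mu> l * ?g (Suc n) l)"
      by (intro has_formal_sum_cmult has_formal_sum_partition_function_Suc)
  next
    fix \<nu> assume "\<nu> \<in> partitions"
    from has_formal_sum_cmult[OF skew_Cauchy[OF Suc.prems this, of a "b (Suc n)", OF t a], of "?g n \<nu>"]
    show "has_formal_sum (\<lambda>l. U_row a \<mu> l * (?g n \<nu> * dual_row (b (Suc n)) \<nu> l)) partitions
        (?g n \<nu> * (?c * (\<Sum>\<kappa>\<in>?P. dual_row (b (Suc n)) \<kappa> \<mu> * U_row a \<kappa> \<nu>)))"
      by (simp only: mult_ac)
  next
    \<comment> \<open>The finite sum over \<kappa> is taken outside, and the induction hypothesis
      applies to each \<kappa>; the result reassembles into the recursion for
      \<open>?g (Suc n) \<mu>\<close>.\<close>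
    have "has_formal_sum (\<lambda>\<nu>. \<Sum>\<kappa>\<in>?P. ?c * dual_row (b (Suc n)) \<kappa> \<mu> * (U_row a \<kappa> \<nu> * ?g n \<nu>)) partitions
        (\<Sum>\<kappa>\<in>?P. ?c * dual_row (b (Suc n)) \<kappa> \<mu> * ((\<Prod>j=1..n. 1 / (1 - t j)) * ?g n \<kappa>))"
      by (intro has_formal_sum_sum finite_partitions_below Suc.prems has_formal_sum_cmult Suc.IH) simp
    moreover have "(\<Sum>\<kappa>\<in>?P. ?c * dual_row (b (Suc n)) \<kappa> \<mu> * (U_row a \<kappa> \<nu> * ?g n \<nu>)) =
        ?g n \<nu> * (?c * (\<Sum>\<kappa>\<in>?P. dual_row (b (Suc n)) \<kappa> \<mu> * U_row a \<kappa> \<nu>))" for \<nu>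
      unfolding sum_distrib_left by (simp only: mult_ac)
    moreover have "(\<Sum>\<kappa>\<in>?P. ?c * dual_row (b (Suc n)) \<kappa> \<mu> * ((\<Prod>j=1..n. 1 / (1 - t j)) * ?g n \<kappa>)) =
        (\<Prod>j=1..Suc n. 1 / (1 - t j)) * ?g (Suc n) \<mu>"
      unfolding partition_function_Suc[OF Suc.prems] sum_distrib_left
      by (intro sum.cong refl) (simp add: mult_ac)
    ultimately show "has_formal_sum (\<lambda>\<nu>. ?g n \<nu> * (?c * (\<Sum>\<kappa>\<in>?P. dual_row (b (Suc n)) \<kappa> \<mu> * U_row a \<kappa> \<nu>)))
        partitions ((\<Prod>j=1..Suc n. 1 / (1 - t j)) * ?g (Suc n) \<mu>)"
      by simp
  qed
qed

text \<open>The first-site exponents of the rows add up along the chain of partitions to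
  \<open>l 1\<close>.\<close>

lemma mdeg_ge_partition_function_U:
  assumes "\<And>i. mdeg_ge (a i 1) 1" "l \<in> partitions"
  shows "mdeg_ge (partition_function m (\<lambda>i s. U_weight (a i s)) l) (l 1)"
  using assms(2)
proof (induction m arbitrary: l)
  case 0
  then show ?case by (auto simp: partition_function_0)
next
  case (Suc m)
  show ?case
    unfolding partition_function_Suc[OF Suc.prems]
  proof (rule mdeg_ge_sum, clarify)
    fix \<mu> assume \<mu>: "\<mu> \<in> partitions" "\<mu> \<le> l"
    have "\<mu> 1 + (l 1 - \<mu> 1) = l 1" using \<mu>(2) by (simp add: le_fun_def)
    then show "mdeg_ge (partition_function m (\<lambda>i s. U_weight (a i s)) \<mu> * U_row (a (Suc m)) \<mu> l) (l 1)"
      using mdeg_ge_mult[OF Suc.IH[OF \<mu>(1)] mdeg_ge_U_row[OF \<mu>(1) Suc.prems, of "a (Suc m)"]] assms(1)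
      by simp
  qed
qed

text \<open>A horizontal strip adds at most one part, so \<open>m\<close> rows reach only partitions
  with at most \<open>m\<close> parts.\<close>

lemma partition_function_U_eq_0:
  assumes "l \<in> partitions" "s > m" "l s \<noteq> 0"
  shows "partition_function m (\<lambda>i s. U_weight (a i s)) l = 0"
  using assms
proof (induction m arbitrary: l s)
  case 0
  then show ?case by (auto simp: partition_function_0)
next
  case (Suc m)
  show ?case
    unfolding partition_function_Suc[OF Suc.prems(1)]
  proof (rule sum.neutral, clarify)
    fix \<mu> assume \<mu>: "\<mu> \<in> partitions" "\<mu> \<le> l"
    show "partition_function m (\<lambda>i s. U_weight (a i s)) \<mu> * U_row (a (Suc m)) \<mu> l = 0"
    proof (cases "U_row (a (Suc m)) \<mu> l = 0")
      case False
      then have "l s \<le> \<mu> (s - 1)"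
        using U_row_nonzero(2)[OF \<mu>(1) Suc.prems(1) False, of "s - 1"] Suc.prems(2) by simp
      then show ?thesis using Suc.IH[OF \<mu>(1), of "s - 1"] Suc.prems by simp
    qed simp
  qed
qed

lemma partition_function_dual_zero:
  "partition_function n (\<lambda>j s. dual_weight (b j s)) (\<lambda>_. 0) = 1"
proof (induction n)
  case 0
  then show ?case by (simp add: partition_function_0)
next
  case (Suc n)
  have "{\<mu> \<in> partitions. \<mu> \<le> (\<lambda>_. 0)} = {\<lambda>_. 0}" by (auto simp: partition_le_zero)
  then show ?case
    using Suc by (simp add: partition_function_Suc row_weight_def dual_weight_def)
qed

text \<open>Induction on the number of \<open>U\<close> rows: the top one is pushed through all dual
  rows at the cost of its factors \<open>1 / (1 - t (Suc m) j)\<close>, leaving the identity for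
  \<open>m\<close> rows.\<close>

lemma Cauchy_identity_mfps:
  fixes a b :: "nat \<Rightarrow> nat \<Rightarrow> ('v, 'a :: comm_ring_1) mfps"
  assumes t: "\<And>i j s. s \<ge> 1 \<Longrightarrow> a i s * b j s = t i j" and a: "\<And>i. mdeg_ge (a i 1) 1"
  shows "has_formal_sum (\<lambda>l. partition_function m (\<lambda>i s. U_weight (a i s)) l *
            partition_function n (\<lambda>j s. dual_weight (b j s)) l) partitions
    (\<Prod>i=1..m. \<Prod>j=1..n. 1 / (1 - t i j))"
proof (induction m)
  case 0
  let ?F = "\<lambda>l. partition_function 0 (\<lambda>i s. U_weight (a i s)) l *
            partition_function n (\<lambda>j s. dual_weight (b j s)) l"
  have "has_formal_sum ?F partitions (\<Sum>l\<in>{\<lambda>_. 0}. ?F l)"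
    by (intro has_formal_sum_finite_support) (auto simp: partition_function_0)
  then show ?case by (simp add: partition_function_0 partition_function_dual_zero)
next
  case (Suc m)
  let ?G = "\<lambda>m. partition_function m (\<lambda>i s. U_weight (a i s))"
  let ?g = "partition_function n (\<lambda>j s. dual_weight (b j s))"
  let ?p = "\<Prod>j=1..n. 1 / (1 - t (Suc m) j)"
  show ?case
  proof (rule has_formal_sum_swap[where J = partitions
        and F = "\<lambda>l \<mu>. ?g l * (?G m \<mu> * U_row (a (Suc m)) \<mu> l)"
        and R = "\<lambda>\<mu>. ?p * (?G m \<mu> * ?g \<mu>)"])
    fix M :: "'v multiset"
    \<comment> \<open>Here no partition is fixed: the length bound comes from the number of
      \<open>U\<close> rows, and the bound on \<open>l 1\<close> from the total degree of those
      rows.\<close>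
    define Box where "Box = {l \<in> partitions. l 1 \<le> size M \<and> (\<forall>s>Suc m. l s = 0)}"
    have "l \<in> Box \<and> \<mu> \<in> Box" if l: "l \<in> partitions" "\<mu> \<in> partitions"
      and nz: "mcoeff (?g l * (?G m \<mu> * U_row (a (Suc m)) \<mu> l)) M \<noteq> 0" for l \<mu>
    proof -
      have "U_row (a (Suc m)) \<mu> l \<noteq> 0" using nz by auto
      note U = U_row_nonzero[OF l(2) l(1) this]
      have le: "\<mu> s \<le> l s" for s using U(1) by (simp add: le_fun_def)
      have "?G m \<mu> \<noteq> 0" using nz by auto
      then have \<mu>0: "\<mu> s = 0" if "s > m" for s
        using partition_function_U_eq_0[OF l(2) that] by blast
      have l0: "l s = 0" if "s > Suc m" for s
        using U(2)[of "s - 1"] \<mu>0[of "s - 1"] that by simp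
      have "mdeg_ge (?g l * (?G m \<mu> * U_row (a (Suc m)) \<mu> l)) (\<mu> 1 + (l 1 - \<mu> 1))"
        by (intro mdeg_ge_mult_right mdeg_ge_mult mdeg_ge_partition_function_U mdeg_ge_U_row l a)
      then have "l 1 \<le> size M" using nz le[of 1] by (force simp: mdeg_ge_def)
      then show ?thesis
        using l l0 \<mu>0 le[of 1] by (auto simp: Box_def)
    qed
    then have "{(l, \<mu>). l \<in> partitions \<and> \<mu> \<in> partitions \<and>
        mcoeff (?g l * (?G m \<mu> * U_row (a (Suc m)) \<mu> l)) M \<noteq> 0} \<subseteq> Box \<times> Box" by auto
    moreover have "finite (Box \<times> Box)" unfolding Box_def by (simp only: finite_cartesian_product finite_partitions_box)
    ultimately show "finite {(l, \<mu>). l \<in> partitions \<and> \<mu> \<in> partitions \<and>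
        mcoeff (?g l * (?G m \<mu> * U_row (a (Suc m)) \<mu> l)) M \<noteq> 0}"
      by (rule finite_subset)
  next
    fix l assume "l \<in> partitions"
    then have "has_formal_sum (\<lambda>\<mu>. ?g l * (?G m \<mu> * U_row (a (Suc m)) \<mu> l)) partitions (?g l * ?G (Suc m) l)"
      by (intro has_formal_sum_cmult has_formal_sum_partition_function_Suc)
    then show "has_formal_sum (\<lambda>\<mu>. ?g l * (?G m \<mu> * U_row (a (Suc m)) \<mu> l)) partitions (?G (Suc m) l * ?g l)"
      by (simp only: mult.commute)
  next
    fix \<mu> assume "\<mu> \<in> partitions"
    from has_formal_sum_cmult[OF U_row_dual_sum[where a = "a (Suc m)" and b = b and t = "t (Suc m)" and n = n, OF t a this], of "?G m \<mu>"]
    show "has_formal_sum (\<lambda>l. ?g l * (?G m \<mu> * U_row (a (Suc m)) \<mu> l)) partitions (?p * (?G m \<mu> * ?g \<mu>))"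
      by (simp only: mult_ac)
  next
    show "has_formal_sum (\<lambda>\<mu>. ?p * (?G m \<mu> * ?g \<mu>)) partitions (\<Prod>i=1..Suc m. \<Prod>j=1..n. 1 / (1 - t i j))"
      using has_formal_sum_cmult[OF Suc.IH, of ?p] by (simp add: mult.commute)
  qed
qed

text \<open>The restriction to \<open>s \<ge> 1\<close> matters because \<open>z 0\<close> may be 0,
  where quotients cannot be rewritten.\<close>

lemma partition_function_cong:
  assumes "\<And>k s. s \<ge> 1 \<Longrightarrow> W k s = W' k s"
  shows "partition_function N W l = partition_function N W' l"
proof -
  have "(\<Prod>s\<in>{s. s \<ge> 1 \<and> W k s (h k s) (v (k - 1) s) (h k (s + 1)) (v k s) \<noteq> 1}.
          W k s (h k s) (v (k - 1) s) (h k (s + 1)) (v k s)) =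
        (\<Prod>s\<in>{s. s \<ge> 1 \<and> W' k s (h k s) (v (k - 1) s) (h k (s + 1)) (v k s) \<noteq> 1}.
          W' k s (h k s) (v (k - 1) s) (h k (s + 1)) (v k s))" for h v k
    using assms by (intro prod.cong) auto
  then show ?thesis by (simp add: partition_function_def Let_def)
qed

theorem theorem6p6:
  fixes m n :: nat and z :: "nat \<Rightarrow> 'a :: field"
  assumes "\<And>s. s \<ge> 1 \<Longrightarrow> z s \<noteq> 0"
  shows "has_formal_sum
           (\<lambda>l. Grothendieck m l (\<lambda>i. mvar (X i)) (\<lambda>s. mconst (z s)) *
                dual_Grothendieck n l (\<lambda>j. mvar (Y j)) (\<lambda>s. mconst (1 / z s)))
           partitions
           (\<Prod>i = 1..m. \<Prod>j = 1..n. 1 / (1 - mvar (X i) * mvar (Y j)))"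
proof -
  \<comment> \<open>Division by a nonzero constant becomes multiplication by its inverse. The dual
    parameter is \<open>1 / z s\<close>, so \<open>z s\<close> cancels in
    \<open>a i s * b j s\<close>.\<close>
  define a :: "nat \<Rightarrow> nat \<Rightarrow> (xy_var, 'a) mfps" where "a i s = mvar (X i) * mconst (1 / z s)" for i s
  define b :: "nat \<Rightarrow> nat \<Rightarrow> (xy_var, 'a) mfps" where "b j s = mvar (Y j) * mconst (z s)" for j s
  have "Grothendieck m l (\<lambda>i. mvar (X i)) (\<lambda>s. mconst (z s)) =
      partition_function m (\<lambda>i s. U_weight (a i s)) l" for l
    unfolding Grothendieck_def a_def
    by (intro partition_function_cong) (simp add: mfps_divide_mconst assms)
  moreover have "dual_Grothendieck n l (\<lambda>j. mvar (Y j)) (\<lambda>s. mconst (1 / z s)) =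
      partition_function n (\<lambda>j s. dual_weight (b j s)) l" for l
    unfolding dual_Grothendieck_def b_def
    by (intro partition_function_cong) (simp add: mfps_divide_mconst assms)
  moreover have "a i s * b j s = mvar (X i) * mvar (Y j)" if "s \<ge> 1" for i j s
  proof -
    have "a i s * b j s = mvar (X i) * mvar (Y j) * (mconst (1 / z s) * mconst (z s))"
      by (simp add: a_def b_def mult_ac)
    also have "mconst (1 / z s) * mconst (z s) = (1 :: (xy_var, 'a) mfps)"
      using assms[OF that] by (simp add: mconst_mult) (simp add: mconst_def one_mfps_def)
    finally show ?thesis by simp
  qed
  moreover have "mdeg_ge (a i 1) 1" for i
    unfolding a_def by (intro mdeg_ge_mult_left mdeg_ge_mvar)
  ultimately show ?thesis
    using Cauchy_identity_mfps[of a b "\<lambda>i j. mvar (X i) * mvar (Y j)" m n] by simp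
qed

end
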